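(* Let $\alpha$ be a simple root in $\Phi$, $\gamma\in\Phi^+\setminus\Phi_J^+$, and $w\in W^J$. Define $z,z'\in W_J$ by $r_\theta w=\lfloor r_\theta w\rfloor z$ and $r_\theta\lfloor wr_\gamma\rfloor=\lfloor r_\theta wr_\gamma\rfloor z'$. Below, "B" denotes a Bruhat edge and "Q" a quantum edge in $\mathrm{QB}(W^J)$, and asserting an edge includes that both endpoints lie in $W^J$. In each "left" item the existence of the two bottom edges implies the existence of the two top edges; in each "right" item the existence of the two top edges implies the existence of the two bottom edges. Moreover, in each item the four edges form two directed paths of length two with common start and common end (a diamond), and the weights of these two paths are congruent modulo $Q_J^\vee$. (1) Assume $\gamma\neq w^{-1}\alpha$. In both items $r_\alpha\lfloor wr_\gamma\rfloor=r_\alpha wr_\gamma=\lfloor r_\alpha wr_\gamma\rfloor$. Left. Bottom: $w\overset{w^{-1}\alpha}{\longrightarrow}r_\alpha w$ (B), $w\overset{\gamma}{\longrightarrow}\lfloor wr_\gamma\rfloor$ (B). Top: $r_\alpha w\overset{\gamma}{\longrightarrow}r_\alpha\lfloor wr_\gamma\rfloor$ (B), $\lfloor wr_\gamma\rfloor\overset{\lfloor wr_\gamma\rfloor^{-1}\alpha}{\longrightarrow}r_\alpha\lfloor wr_\gamma\rfloor$ (B). Right. Top: $w\overset{\gamma}{\longrightarrow}\lfloor wr_\gamma\rfloor$ (B), $r_\alpha\lfloor wr_\gamma\rfloor\overset{-\lfloor wr_\gamma\rfloor^{-1}\alpha}{\longrightarrow}\lfloor wr_\gamma\rfloor$ (B).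 Bottom: $r_\alpha w\overset{-w^{-1}\alpha}{\longrightarrow}w$ (B), $r_\alpha w\overset{\gamma}{\longrightarrow}r_\alpha\lfloor wr_\gamma\rfloor$ (B). (2) In both items $r_\alpha\lfloor wr_\gamma\rfloor=\lfloor r_\alpha wr_\gamma\rfloor$. Left. Bottom: $w\overset{w^{-1}\alpha}{\longrightarrow}r_\alpha w$ (B), $w\overset{\gamma}{\longrightarrow}\lfloor wr_\gamma\rfloor$ (Q). Top: $r_\alpha w\overset{\gamma}{\longrightarrow}r_\alpha\lfloor wr_\gamma\rfloor$ (Q), $\lfloor wr_\gamma\rfloor\overset{\lfloor wr_\gamma\rfloor^{-1}\alpha}{\longrightarrow}r_\alpha\lfloor wr_\gamma\rfloor$ (B). Right. Top: $w\overset{\gamma}{\longrightarrow}\lfloor wr_\gamma\rfloor$ (Q), $r_\alpha\lfloor wr_\gamma\rfloor\overset{-\lfloor wr_\gamma\rfloor^{-1}\alpha}{\longrightarrow}\lfloor wr_\gamma\rfloor$ (B). Bottom: $r_\alpha w\overset{-w^{-1}\alpha}{\longrightarrow}w$ (B), $r_\alpha w\overset{\gamma}{\longrightarrow}r_\alpha\lfloor wr_\gamma\rfloor$ (Q). (3) In all items of (3), $wr_\gamma=\lfloor wr_\gamma\rfloor$. (3a) Assume $\langle\gamma^\vee,w^{-1}\theta\rangle\neq0$. Left. Bottom: $w\overset{-w^{-1}\theta}{\longrightarrow}\lfloor r_\theta w\rfloor$ (Q), $w\overset{\gamma}{\longrightarrow}\lfloor wr_\gamma\rfloor$ (B). Top: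 $\lfloor r_\theta w\rfloor\overset{z\gamma}{\longrightarrow}\lfloor r_\theta wr_\gamma\rfloor$ (Q), $\lfloor wr_\gamma\rfloor\overset{-\lfloor wr_\gamma\rfloor^{-1}\theta}{\longrightarrow}\lfloor r_\theta wr_\gamma\rfloor$ (Q). Right. Top: $w\overset{\gamma}{\longrightarrow}\lfloor wr_\gamma\rfloor$ (B), $\lfloor r_\theta wr_\gamma\rfloor\overset{z'\lfloor wr_\gamma\rfloor^{-1}\theta}{\longrightarrow}\lfloor wr_\gamma\rfloor$ (Q). Bottom: $\lfloor r_\theta w\rfloor\overset{zw^{-1}\theta}{\longrightarrow}w$ (Q), $\lfloor r_\theta w\rfloor\overset{z\gamma}{\longrightarrow}\lfloor r_\theta wr_\gamma\rfloor$ (Q). (3b) Assume $\langle\gamma^\vee,w^{-1}\theta\rangle=0$. Left. Bottom: $w\overset{-w^{-1}\theta}{\longrightarrow}\lfloor r_\theta w\rfloor$ (Q), $w\overset{\gamma}{\longrightarrow}\lfloor wr_\gamma\rfloor$ (B). Top: $\lfloor r_\theta w\rfloor\overset{z\gamma}{\longrightarrow}\lfloor r_\theta wr_\gamma\rfloor$ (B), $\lfloor wr_\gamma\rfloor\overset{-\lfloor wr_\gamma\rfloor^{-1}\theta}{\longrightarrow}\lfloor r_\theta wr_\gamma\rfloor$ (Q). Right. Top: $w\overset{\gamma}{\longrightarrow}\lfloor wr_\gamma\rfloor$ (B), $\lfloor r_\theta wr_\gamma\rfloor\overset{z'\lfloor wr_\gamma\rfloor^{-1}\theta}{\longrightarrow}\lfloor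 wr_\gamma\rfloor$ (Q). Bottom: $\lfloor r_\theta w\rfloor\overset{zw^{-1}\theta}{\longrightarrow}w$ (Q), $\lfloor r_\theta w\rfloor\overset{z\gamma}{\longrightarrow}\lfloor r_\theta wr_\gamma\rfloor$ (B). (4) Assume $\gamma\neq-w^{-1}\theta$ in all items of (4). (4a) Assume $\langle\gamma^\vee,w^{-1}\theta\rangle\neq0$. Left. Bottom: $w\overset{-w^{-1}\theta}{\longrightarrow}\lfloor r_\theta w\rfloor$ (Q), $w\overset{\gamma}{\longrightarrow}\lfloor wr_\gamma\rfloor$ (Q). Top: $\lfloor r_\theta w\rfloor\overset{z\gamma}{\longrightarrow}\lfloor r_\theta wr_\gamma\rfloor$ (B), $\lfloor wr_\gamma\rfloor\overset{-\lfloor wr_\gamma\rfloor^{-1}\theta}{\longrightarrow}\lfloor r_\theta wr_\gamma\rfloor$ (Q). Right. Top: $w\overset{\gamma}{\longrightarrow}\lfloor wr_\gamma\rfloor$ (Q), $\lfloor r_\theta wr_\gamma\rfloor\overset{z'\lfloor wr_\gamma\rfloor^{-1}\theta}{\longrightarrow}\lfloor wr_\gamma\rfloor$ (Q). Bottom: $\lfloor r_\theta w\rfloor\overset{zw^{-1}\theta}{\longrightarrow}w$ (Q), $\lfloor r_\theta w\rfloor\overset{z\gamma}{\longrightarrow}\lfloor r_\theta wr_\gamma\rfloor$ (B). (4b) Assume $\langle\gamma^\vee,w^{-1}\theta\rangle=0$. Left. Bottom: $w\overset{-w^{-1}\theta}{\longrightarrow}\lfloor r_\theta w\rfloor$ (Q),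 $w\overset{\gamma}{\longrightarrow}\lfloor wr_\gamma\rfloor$ (Q). Top: $\lfloor r_\theta w\rfloor\overset{z\gamma}{\longrightarrow}\lfloor r_\theta wr_\gamma\rfloor$ (Q), $\lfloor wr_\gamma\rfloor\overset{-\lfloor wr_\gamma\rfloor^{-1}\theta}{\longrightarrow}\lfloor r_\theta wr_\gamma\rfloor$ (Q). Right. Top: $w\overset{\gamma}{\longrightarrow}\lfloor wr_\gamma\rfloor$ (Q), $\lfloor r_\theta wr_\gamma\rfloor\overset{z'\lfloor wr_\gamma\rfloor^{-1}\theta}{\longrightarrow}\lfloor wr_\gamma\rfloor$ (Q). Bottom: $\lfloor r_\theta w\rfloor\overset{zw^{-1}\theta}{\longrightarrow}w$ (Q), $\lfloor r_\theta w\rfloor\overset{z\gamma}{\longrightarrow}\lfloor r_\theta wr_\gamma\rfloor$ (Q).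
   Context: $\Phi$ is the (irreducible) root system of a finite-dimensional simple Lie algebra, with Dynkin node set $I$, simple roots $\alpha_i$, simple coroots $\alpha_i^\vee$, positive roots $\Phi^+$, highest root $\theta$, Weyl group $W$ with length $\ell$, reflections $r_\alpha$, $\rho=\frac12\sum_{\alpha\in\Phi^+}\alpha$; $\langle\cdot,\cdot\rangle$ is the coroot–root pairing. $J\subseteq I$ is a subset, $W_J=\langle r_i:i\in J\rangle$, $\Phi_J^+\subseteq\Phi^+$ the positive roots of its root system $\Phi_J$, $\rho_J=\frac12\sum_{\alpha\in\Phi_J^+}\alpha$, $Q_J^\vee=\bigoplus_{i\in J}\mathbb{Z}\alpha_i^\vee$, $W^J$ the set of minimum-length coset representatives of $W/W_J$, and $\lfloor w\rfloor\in W^J$ the minimum-length representative of $wW_J$. The parabolic quantum Bruhat graph $\mathrm{QB}(W^J)$ is the directed graph with vertex set $W^J$ and, for $w\in W^J$ and $\alpha\in\Phi^+\setminus\Phi_J^+$, an edge $w\overset{\alpha}{\longrightarrow}\lfloor wr_\alpha\rfloor$ labeled $\alpha$ if either (Bruhat edge) $\ell(wr_\alpha)=\ell(w)+1$ (then $wr_\alpha\in W^J$), or (quantum edge) $\ell(\lfloor wr_\alpha\rfloor)=\ell(w)+1-\langle\alpha^\vee,2\rho-2\rho_J\rangle$. The weight of an edge labeled $\alpha$ is $\alpha^\vee$ if it is a quantum edge and $0$ if it is a Bruhat edge; the weight of a directed path is the sum of the weights of its edges. *)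

theory Defs
  imports "HOL-Analysis.Analysis"
begin

section \<open>Root systems\<close>

text \<open>
  Root systems live in a Euclidean space whose inner product plays the role of a Weyl group
  invariant form.  The form identifies the space with its dual, so that the coroot--root pairing
  is the inner product \<open>coroot \<alpha> \<bullet> \<beta>\<close>.
\<close>

definition coroot :: "'a::euclidean_space \<Rightarrow> 'a" where
  "coroot \<alpha> = (2 / (\<alpha> \<bullet> \<alpha>)) *\<^sub>R \<alpha>"

definition root_refl :: "'a::euclidean_space \<Rightarrow> 'a \<Rightarrow> 'a" where
  "root_refl \<alpha> v = v - (coroot \<alpha> \<bullet> v) *\<^sub>R \<alpha>"

definition root_system :: "'a::euclidean_space set \<Rightarrow> bool" where
  "root_system \<Phi> \<longleftrightarrow>
     finite \<Phi> \<and> 0 \<notin> \<Phi> \<and> span \<Phi> = UNIV \<and>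
     (\<forall>\<alpha>\<in>\<Phi>. root_refl \<alpha> ` \<Phi> \<subseteq> \<Phi>) \<and>
     (\<forall>\<alpha>\<in>\<Phi>. \<forall>\<beta>\<in>\<Phi>. coroot \<alpha> \<bullet> \<beta> \<in> \<int>) \<and>
     (\<forall>\<alpha>\<in>\<Phi>. \<forall>c. c *\<^sub>R \<alpha> \<in> \<Phi> \<longrightarrow> c = 1 \<or> c = -1)"

definition irreducible_root_system :: "'a::euclidean_space set \<Rightarrow> bool" where
  "irreducible_root_system \<Phi> \<longleftrightarrow>
     root_system \<Phi> \<and> \<Phi> \<noteq> {} \<and>
     \<not> (\<exists>A B. A \<noteq> {} \<and> B \<noteq> {} \<and> A \<union> B = \<Phi> \<and> (\<forall>a\<in>A. \<forall>b\<in>B. a \<bullet> b = 0))"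

definition nat_span :: "'a::real_vector set \<Rightarrow> 'a set" where
  "nat_span S = {\<Sum>\<beta>\<in>S. of_nat (c \<beta>) *\<^sub>R \<beta> | c :: 'a \<Rightarrow> nat. True}"

definition int_span :: "'a::real_vector set \<Rightarrow> 'a set" where
  "int_span S = {\<Sum>\<beta>\<in>S. of_int (c \<beta>) *\<^sub>R \<beta> | c :: 'a \<Rightarrow> int. True}"

definition simple_roots :: "'a::euclidean_space set \<Rightarrow> 'a set \<Rightarrow> bool" where
  "simple_roots \<Phi> \<Delta> \<longleftrightarrow>
     \<Delta> \<subseteq> \<Phi> \<and> independent \<Delta> \<and> (\<forall>\<beta>\<in>\<Phi>. \<beta> \<in> nat_span \<Delta> \<or> - \<beta> \<in> nat_span \<Delta>)"

text \<open>
  From here on \<open>\<Phi>\<close> is the root system, \<open>\<Delta>\<close> its set of simple roots and \<open>J \<subseteq> \<Delta>\<close>: the Dynkin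
  nodes are identified with the simple roots.
\<close>

definition pos_roots :: "'a::euclidean_space set \<Rightarrow> 'a set \<Rightarrow> 'a set" where
  "pos_roots \<Phi> \<Delta> = \<Phi> \<inter> nat_span \<Delta>"

text \<open>The positive roots of \<open>\<Phi>\<^sub>J = \<Phi> \<inter> Q\<^sub>J\<close>, where \<open>Q\<^sub>J\<close> is the lattice spanned by \<open>J\<close>.\<close>

definition pos_roots_sub :: "'a::euclidean_space set \<Rightarrow> 'a set \<Rightarrow> 'a set \<Rightarrow> 'a set" where
  "pos_roots_sub \<Phi> \<Delta> J = pos_roots \<Phi> \<Delta> \<inter> int_span J"

definition highest_root :: "'a::euclidean_space set \<Rightarrow> 'a set \<Rightarrow> 'a \<Rightarrow> bool" where
  "highest_root \<Phi> \<Delta> \<theta> \<longleftrightarrow> \<theta> \<in> \<Phi> \<and> (\<forall>\<beta>\<in>\<Phi>. \<theta> - \<beta> \<in> nat_span \<Delta>)"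

definition half_sum :: "'a::euclidean_space set \<Rightarrow> 'a" where
  "half_sum R = (1/2) *\<^sub>R (\<Sum>\<beta>\<in>R. \<beta>)"

definition coroot_lattice :: "'a::euclidean_space set \<Rightarrow> 'a set" where
  "coroot_lattice J = int_span (coroot ` J)"


section \<open>Weyl group, length and minimal coset representatives\<close>

definition word_prod :: "'a::euclidean_space list \<Rightarrow> 'a \<Rightarrow> 'a" where
  "word_prod as = foldr (\<lambda>\<alpha> w. root_refl \<alpha> \<circ> w) as id"

text \<open>
  The group generated by the reflections in the elements of \<open>J\<close>.  Reflections are involutions, so
  products of generators suffice.  The whole Weyl group is \<open>weyl_group \<Delta>\<close>.
\<close>

definition weyl_group :: "'a::euclidean_space set \<Rightarrow> ('a \<Rightarrow> 'a) set" where
  "weyl_group J = {word_prod as | as. set as \<subseteq> J}"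

definition weyl_length :: "'a::euclidean_space set \<Rightarrow> ('a \<Rightarrow> 'a) \<Rightarrow> nat" where
  "weyl_length \<Delta> w = (LEAST n. \<exists>as. set as \<subseteq> \<Delta> \<and> length as = n \<and> word_prod as = w)"

definition lcoset :: "'a::euclidean_space set \<Rightarrow> ('a \<Rightarrow> 'a) \<Rightarrow> ('a \<Rightarrow> 'a) set" where
  "lcoset J w = (\<lambda>u. w \<circ> u) ` weyl_group J"

definition min_reps :: "'a::euclidean_space set \<Rightarrow> 'a set \<Rightarrow> ('a \<Rightarrow> 'a) set" where
  "min_reps \<Delta> J =
     {w \<in> weyl_group \<Delta>. \<forall>u \<in> lcoset J w. weyl_length \<Delta> w \<le> weyl_length \<Delta> u}"

text \<open>
  Each coset contains exactly one element of minimal length, so the choice made by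
  \<open>arg_min_on\<close> is immaterial.
\<close>

definition min_rep :: "'a::euclidean_space set \<Rightarrow> 'a set \<Rightarrow> ('a \<Rightarrow> 'a) \<Rightarrow> ('a \<Rightarrow> 'a)" where
  "min_rep \<Delta> J w = arg_min_on (weyl_length \<Delta>) (lcoset J w)"


section \<open>The parabolic quantum Bruhat graph\<close>

text \<open>
  An edge records its kind.  The kind is determined by source and label, since the pairing
  \<open>coroot \<alpha> \<bullet> (2\<rho> - 2\<rho>\<^sub>J)\<close> is positive for every positive root \<open>\<alpha>\<close> outside \<open>\<Phi>\<^sub>J\<close>.
  Weyl group elements are functions, so the product is composition.
\<close>

datatype edge_kind = Bruhat | Quantum

datatype 'a edge =
  Edge (source: "'a \<Rightarrow> 'a") (label: 'a) (kind: edge_kind) (target: "'a \<Rightarrow> 'a")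

definition qb_edge ::
  "'a::euclidean_space set \<Rightarrow> 'a set \<Rightarrow> 'a set \<Rightarrow> 'a edge \<Rightarrow> bool" where
  "qb_edge \<Phi> \<Delta> J e \<longleftrightarrow>
     source e \<in> min_reps \<Delta> J \<and> target e \<in> min_reps \<Delta> J \<and>
     label e \<in> pos_roots \<Phi> \<Delta> - pos_roots_sub \<Phi> \<Delta> J \<and>
     target e = min_rep \<Delta> J (source e \<circ> root_refl (label e)) \<and>
     (case kind e of
        Bruhat \<Rightarrow>
          weyl_length \<Delta> (source e \<circ> root_refl (label e)) = weyl_length \<Delta> (source e) + 1
      | Quantum \<Rightarrow>
          real (weyl_length \<Delta> (min_rep \<Delta> J (source e \<circ> root_refl (label e)))) =
            real (weyl_length \<Delta> (source e)) + 1
              - coroot (label e) \<bullet>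
                  (2 *\<^sub>R half_sum (pos_roots \<Phi> \<Delta>) - 2 *\<^sub>R half_sum (pos_roots_sub \<Phi> \<Delta> J)))"

definition edge_weight :: "'a::euclidean_space edge \<Rightarrow> 'a" where
  "edge_weight e = (case kind e of Bruhat \<Rightarrow> 0 | Quantum \<Rightarrow> coroot (label e))"

fun qb_path ::
  "'a::euclidean_space set \<Rightarrow> 'a set \<Rightarrow> 'a set \<Rightarrow>
     ('a \<Rightarrow> 'a) \<Rightarrow> 'a edge list \<Rightarrow> ('a \<Rightarrow> 'a) \<Rightarrow> bool" where
  "qb_path \<Phi> \<Delta> J x [] y \<longleftrightarrow> x \<in> min_reps \<Delta> J \<and> x = y"
| "qb_path \<Phi> \<Delta> J x (e # p) y \<longleftrightarrow>
     qb_edge \<Phi> \<Delta> J e \<and> source e = x \<and> qb_path \<Phi> \<Delta> J (target e) p y"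

definition path_weight :: "'a::euclidean_space edge list \<Rightarrow> 'a" where
  "path_weight p = sum_list (map edge_weight p)"

definition diamond ::
  "'a::euclidean_space set \<Rightarrow> 'a set \<Rightarrow> 'a set \<Rightarrow> 'a edge list \<Rightarrow> 'a edge list \<Rightarrow> bool" where
  "diamond \<Phi> \<Delta> J p q \<longleftrightarrow>
     length p = 2 \<and> length q = 2 \<and>
     (\<exists>x y. qb_path \<Phi> \<Delta> J x p y \<and> qb_path \<Phi> \<Delta> J x q y) \<and>
     path_weight p - path_weight q \<in> coroot_lattice J"

end

theory Submission
  imports Defs
begin

text \<open>
  The edges of the parabolic quantum Bruhat graph are the covers of the semi-infinite Bruhat
  order on the affine Weyl group, taken modulo the affine Weyl group of \<open>\<Phi>\<^sub>J\<close> and modulo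
  translations, and the diamonds are the exchange diamonds for left multiplication by a simple
  affine reflection.  The proof carries this out without leaving the finite Weyl group.

  Let \<open>R\<close> (\<open>outer\<close> below) be the set of positive roots outside \<open>\<Phi>\<^sub>J\<close>, let \<open>N(v)\<close> (\<open>plen\<close>) count the
  roots of \<open>R\<close> that \<open>v\<close> makes negative, and let \<open>h(\<delta>)\<close> (\<open>pairing\<close>) be the sum of the pairings of
  the coroot of \<open>\<delta>\<close> with the roots in \<open>R\<close>, which is its pairing with \<open>2\<rho> - 2\<rho>\<^sub>J\<close>.  Since \<open>W\<^sub>J\<close>
  permutes \<open>R\<close>, the number \<open>N(v)\<close> is the length of the minimal representative of \<open>v W\<^sub>J\<close>.  For
  \<open>\<gamma> \<in> R\<close> put
    \<open>D(v, \<gamma>) = N(v r\<^sub>\<gamma>) - N(v) + [v \<gamma> < 0] h(\<gamma>)\<close>  (\<open>excess\<close>).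
  Then \<open>D(v, \<gamma>) \<ge> 1\<close> (\<open>excess_ge_1\<close>): if \<open>v \<gamma> > 0\<close>, multiplying by \<open>r\<^sub>\<gamma>\<close> raises the length of
  minimal representatives, and if \<open>v \<gamma> < 0\<close>, a comparison root by root bounds the drop of \<open>N\<close> by
  \<open>h(\<gamma>) - 1\<close>.  For \<open>w \<in> W\<^sup>J\<close> and \<open>\<gamma> \<in> R\<close> there is an edge out of \<open>w\<close> labelled \<open>\<gamma>\<close> exactly if
  \<open>D(w, \<gamma>) = 1\<close>, and it is a Bruhat edge if \<open>w \<gamma> > 0\<close> and a quantum edge if \<open>w \<gamma> < 0\<close>
  (\<open>edge_iff\<close>).

  Let \<open>\<psi>\<close> be a simple root or \<open>- \<theta>\<close>.  In both cases the reflection in \<open>\<psi>\<close> changes the sign of a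
  root \<open>\<eta>\<close> by the rule
    \<open>[r\<^sub>\<psi> \<eta> < 0] = [\<eta> < 0] + [\<eta> = \<psi>] - [\<eta> = - \<psi>] - [\<psi> < 0] \<langle>\<psi>\<^sup>\<or>, \<eta>\<rangle>\<close>,
  which for \<open>- \<theta>\<close> rests on \<open>\<langle>\<theta>\<^sup>\<or>, \<eta>\<rangle>\<close> being 0 or 1 for the positive roots \<open>\<eta> \<noteq> \<theta>\<close>.  Summing over
  \<open>\<eta> \<in> v R\<close> gives \<open>N(r\<^sub>\<psi> v)\<close>.  It follows that the edge from the coset of \<open>v\<close> to that of \<open>r\<^sub>\<psi> v\<close>
  exists whenever \<open>v\<^sup>-\<^sup>1 \<psi> \<in> R\<close>, and that for \<open>\<gamma> \<noteq> \<plusminus>v\<^sup>-\<^sup>1 \<psi>\<close>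
    \<open>D(r\<^sub>\<psi> v, \<gamma>) = D(v, \<gamma>) + \<epsilon>(r\<^sub>\<gamma> v\<^sup>-\<^sup>1 \<psi>) - \<epsilon>(v\<^sup>-\<^sup>1 \<psi>)\<close>,
  where \<open>\<epsilon>\<close> (\<open>side\<close>) is 1 on \<open>R\<close>, -1 on \<open>- R\<close> and 0 elsewhere (\<open>excess_reflected\<close>).

  If \<open>w\<^sup>-\<^sup>1 \<psi> \<in> R\<close> and \<open>D(w, \<gamma>) = 1\<close>, then the bound \<open>D(r\<^sub>\<psi> w, \<gamma>) \<ge> 1\<close> forces
  \<open>\<epsilon>(r\<^sub>\<gamma> w\<^sup>-\<^sup>1 \<psi>) = 1\<close> and \<open>D(r\<^sub>\<psi> w, \<gamma>) = 1\<close>, which give the two remaining edges of the diamond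
  (\<open>diamond_up\<close>, the left items).  If \<open>r\<^sub>\<gamma> w\<^sup>-\<^sup>1 \<psi> \<in> - R\<close> instead, it forces \<open>w\<^sup>-\<^sup>1 \<psi> \<in> - R\<close> and
  \<open>D(r\<^sub>\<psi> w, \<gamma>) = 1\<close> (\<open>diamond_down\<close>, the right items).  The kinds of the edges and the congruence
  of the weights follow from the sign rule for \<open>\<eta> = w \<gamma>\<close>.
\<close>

section \<open>Reflections and the groups they generate\<close>

lemma coroot_inner_self: "a \<noteq> 0 \<Longrightarrow> coroot a \<bullet> a = 2"
  by (simp add: coroot_def)

lemma coroot_uminus [simp]: "coroot (- a) = - coroot a"
  by (simp add: coroot_def)

lemma root_refl_uminus_root [simp]: "root_refl (- a) = root_refl a"
  by (rule ext) (simp add: root_refl_def)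

lemma root_refl_self: "a \<noteq> 0 \<Longrightarrow> root_refl a a = - a"
  by (simp add: root_refl_def coroot_inner_self scaleR_2)

lemma root_refl_linear: "linear (root_refl a)"
  unfolding root_refl_def by (rule linearI) (simp_all add: algebra_simps inner_simps)

lemma root_refl_inner: "root_refl a u \<bullet> root_refl a v = u \<bullet> v"
proof (cases "a = 0")
  case True
  then show ?thesis by (simp add: root_refl_def)
next
  case False
  have "root_refl a u \<bullet> root_refl a v =
      u \<bullet> v - 2 * (2 / (a \<bullet> a)) * (a \<bullet> u) * (a \<bullet> v) +
      (2 / (a \<bullet> a)) * (2 / (a \<bullet> a)) * (a \<bullet> a) * (a \<bullet> u) * (a \<bullet> v)"
    by (simp add: root_refl_def coroot_def inner_simps inner_commute algebra_simps)
  also have "\<dots> = u \<bullet> v" using False by simp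
  finally show ?thesis .
qed

lemma root_refl_orthogonal: "orthogonal_transformation (root_refl a)"
  unfolding orthogonal_transformation_def using root_refl_linear root_refl_inner by blast

lemma root_refl_involution [simp]: "root_refl a (root_refl a v) = v"
proof (cases "a = 0")
  case False
  then show ?thesis
    by (simp add: root_refl_def inner_simps coroot_inner_self algebra_simps)
qed (simp add: root_refl_def)

lemma root_refl_comp_self [simp]: "root_refl a \<circ> root_refl a = id"
  by (rule ext) simp

lemma root_refl_comp_cancel: "root_refl a \<circ> (root_refl a \<circ> w) = w"
  by (rule ext) simp

lemma root_refl_comp_cancel_right: "w \<circ> root_refl a \<circ> root_refl a = w"
  by (rule ext) simp

lemma coroot_orthogonal:
  assumes "orthogonal_transformation g"
  shows "coroot (g a) = g (coroot a)"
  using assms unfolding coroot_def orthogonal_transformation_def by (simp add: linear_cmul)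

lemma coroot_orthogonal_inner:
  assumes "orthogonal_transformation g"
  shows "coroot (g a) \<bullet> g v = coroot a \<bullet> v"
  using assms coroot_orthogonal unfolding orthogonal_transformation_def by metis

lemma root_refl_conjugate:
  assumes "orthogonal_transformation g"
  shows "root_refl (g a) \<circ> g = g \<circ> root_refl a"
proof
  fix v
  have "linear g" using assms by (simp add: orthogonal_transformation_def)
  then show "(root_refl (g a) \<circ> g) v = (g \<circ> root_refl a) v"
    by (simp add: root_refl_def coroot_orthogonal_inner[OF assms] linear_diff linear_cmul)
qed

lemma coroot_root_refl:
  "coroot (root_refl a b) = coroot b - (coroot b \<bullet> a) *\<^sub>R coroot a"
proof -
  have "coroot (root_refl a b) = root_refl a (coroot b)"
    by (rule coroot_orthogonal[OF root_refl_orthogonal])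
  also have "\<dots> = coroot b - (coroot a \<bullet> coroot b) *\<^sub>R a" by (simp add: root_refl_def)
  also have "(coroot a \<bullet> coroot b) *\<^sub>R a = (coroot b \<bullet> a) *\<^sub>R coroot a"
    by (simp add: coroot_def inner_commute)
  finally show ?thesis .
qed

lemma word_prod_Nil [simp]: "word_prod [] = id"
  by (simp add: word_prod_def)

lemma word_prod_Cons [simp]: "word_prod (a # as) = root_refl a \<circ> word_prod as"
  by (simp add: word_prod_def)

lemma word_prod_append: "word_prod (as @ bs) = word_prod as \<circ> word_prod bs"
  by (induction as) (simp_all add: comp_assoc)

lemma weyl_groupI: "set as \<subseteq> J \<Longrightarrow> word_prod as \<in> weyl_group J"
  by (auto simp: weyl_group_def)

lemma weyl_group_id [simp]: "id \<in> weyl_group J"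
  using weyl_groupI[of "[]" J] by simp

lemma weyl_group_refl: "a \<in> J \<Longrightarrow> root_refl a \<in> weyl_group J"
  using weyl_groupI[of "[a]" J] by simp

lemma weyl_group_comp:
  assumes "v \<in> weyl_group J" "w \<in> weyl_group J"
  shows "v \<circ> w \<in> weyl_group J"
proof -
  obtain as bs where "v = word_prod as" "set as \<subseteq> J" "w = word_prod bs" "set bs \<subseteq> J"
    using assms by (auto simp: weyl_group_def)
  then show ?thesis using weyl_groupI[of "as @ bs" J] by (simp add: word_prod_append)
qed

lemma weyl_group_mono: "J \<subseteq> K \<Longrightarrow> weyl_group J \<subseteq> weyl_group K"
  by (auto simp: weyl_group_def)

lemma weyl_group_induct [consumes 1, case_names id refl]:
  assumes "w \<in> weyl_group J" "P id"
    "\<And>a w. a \<in> J \<Longrightarrow> w \<in> weyl_group J \<Longrightarrow> P w \<Longrightarrow> P (root_refl a \<circ> w)"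
  shows "P w"
proof -
  obtain as where "w = word_prod as" "set as \<subseteq> J"
    using assms(1) by (auto simp: weyl_group_def)
  then show ?thesis
  proof (induction as arbitrary: w)
    case Nil
    then show ?case using assms(2) by (metis word_prod_Nil)
  next
    case (Cons a as)
    then have "P (word_prod as)" "a \<in> J" "word_prod as \<in> weyl_group J" 
      by (auto intro: weyl_groupI)
    then have "P (root_refl a \<circ> word_prod as)" using assms(3) by blast
    then show ?case using Cons.prems by (metis word_prod_Cons)
  qed
qed

lemma weyl_group_orthogonal:
  "w \<in> weyl_group J \<Longrightarrow> orthogonal_transformation w"
proof (induction rule: weyl_group_induct)
  case id
  then show ?case by (simp add: orthogonal_transformation_def linear_id[unfolded id_def] id_def)
next
  case (refl a w)
  then show ?case using root_refl_orthogonal orthogonal_transformation_compose by blast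
qed

lemma weyl_group_bij: "w \<in> weyl_group J \<Longrightarrow> bij w"
  by (simp add: orthogonal_transformation_bij weyl_group_orthogonal)

lemma weyl_group_inv: "w \<in> weyl_group J \<Longrightarrow> inv w \<in> weyl_group J"
proof (induction rule: weyl_group_induct)
  case id
  show ?case by (metis inv_id weyl_group_id)
next
  case (refl a w)
  have "inv (root_refl a) = root_refl a" by (rule inv_equality) simp_all
  moreover have "bij (root_refl a)" by (rule orthogonal_transformation_bij[OF root_refl_orthogonal])
  ultimately have "inv (root_refl a \<circ> w) = inv w \<circ> root_refl a"
    using refl by (simp add: o_inv_distrib weyl_group_bij)
  then show ?case using refl by (metis weyl_group_comp weyl_group_refl)
qed

lemma weyl_group_minus: "w \<in> weyl_group J \<Longrightarrow> w (- x) = - w x"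
  using weyl_group_orthogonal orthogonal_transformation_linear linear_neg by blast

lemma weyl_inv_apply [simp]:
  assumes "w \<in> weyl_group J"
  shows "w (inv w x) = x" "inv w (w x) = x" "w \<circ> inv w = id" "inv w \<circ> w = id"
proof -
  have "bij w" using assms by (rule weyl_group_bij)
  then have "surj w" "inj w" by (simp_all add: bij_def)
  then show 1: "w (inv w x) = x" and 2: "inv w (w x) = x" for x
    by (simp_all add: surj_f_inv_f)
  show "w \<circ> inv w = id" by (rule ext) (simp add: 1)
  show "inv w \<circ> w = id" by (rule ext) (simp add: 2)
qed

lemma weyl_refl_conjugate:
  assumes "w \<in> weyl_group J"
  shows "w \<circ> root_refl (inv w a) = root_refl a \<circ> w"
  using root_refl_conjugate[OF weyl_group_orthogonal[OF assms], of "inv w a"] assms by simp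

lemma lcoset_iff: "x \<in> lcoset J w \<longleftrightarrow> (\<exists>u \<in> weyl_group J. x = w \<circ> u)"
  by (auto simp: lcoset_def)

lemma lcoset_comp_subset:
  assumes "u \<in> weyl_group J"
  shows "lcoset J (w \<circ> u) \<subseteq> lcoset J w"
proof
  fix x assume "x \<in> lcoset J (w \<circ> u)"
  then obtain v where v: "v \<in> weyl_group J" "x = w \<circ> u \<circ> v" by (auto simp only: lcoset_iff)
  then have "x = w \<circ> (u \<circ> v)" by (simp only: comp_assoc)
  then show "x \<in> lcoset J w" using weyl_group_comp[OF assms v(1)] lcoset_iff by blast
qed

lemma lcoset_comp:
  assumes "u \<in> weyl_group J"
  shows "lcoset J (w \<circ> u) = lcoset J w"
proof
  show "lcoset J (w \<circ> u) \<subseteq> lcoset J w" by (rule lcoset_comp_subset[OF assms])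
  have "lcoset J (w \<circ> u \<circ> inv u) \<subseteq> lcoset J (w \<circ> u)"
    by (rule lcoset_comp_subset[OF weyl_group_inv[OF assms]])
  then show "lcoset J w \<subseteq> lcoset J (w \<circ> u)"
    by (simp only: comp_assoc weyl_inv_apply[OF assms] comp_id)
qed

section \<open>Integral and natural spans\<close>

lemma int_spanI: "x = (\<Sum>\<beta>\<in>S. of_int (c \<beta>) *\<^sub>R \<beta>) \<Longrightarrow> x \<in> int_span S"
  unfolding int_span_def by blast

lemma int_span_0: "0 \<in> int_span S"
proof -
  have "0 = (\<Sum>\<beta>\<in>S. of_int ((\<lambda>_. 0) \<beta>) *\<^sub>R \<beta>)" by simp
  then show ?thesis by (rule int_spanI)
qed

lemma int_span_add:
  assumes "x \<in> int_span S" "y \<in> int_span S"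
  shows "x + y \<in> int_span S"
proof -
  obtain c d where "x = (\<Sum>\<beta>\<in>S. of_int (c \<beta>) *\<^sub>R \<beta>)" "y = (\<Sum>\<beta>\<in>S. of_int (d \<beta>) *\<^sub>R \<beta>)"
    using assms unfolding int_span_def by blast
  then have "x + y = (\<Sum>\<beta>\<in>S. of_int ((\<lambda>b. c b + d b) \<beta>) *\<^sub>R \<beta>)"
    by (simp add: scaleR_add_left sum.distrib)
  then show ?thesis by (rule int_spanI)
qed

lemma int_span_scale:
  assumes "x \<in> int_span S"
  shows "of_int k *\<^sub>R x \<in> int_span S"
proof -
  obtain c where "x = (\<Sum>\<beta>\<in>S. of_int (c \<beta>) *\<^sub>R \<beta>)"
    using assms unfolding int_span_def by blast
  then have "of_int k *\<^sub>R x = (\<Sum>\<beta>\<in>S. of_int ((\<lambda>b. k * c b) \<beta>) *\<^sub>R \<beta>)"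
    by (simp add: scaleR_sum_right)
  then show ?thesis by (rule int_spanI)
qed

lemma int_span_uminus: "x \<in> int_span S \<Longrightarrow> - x \<in> int_span S"
  using int_span_scale[of x S "-1"] by simp

lemma int_span_diff: "x \<in> int_span S \<Longrightarrow> y \<in> int_span S \<Longrightarrow> x - y \<in> int_span S"
  using int_span_add[of x S "- y"] int_span_uminus[of y S] by simp

lemma int_span_base:
  assumes "finite S" "x \<in> S"
  shows "x \<in> int_span S"
proof -
  have "(\<Sum>\<beta>\<in>S. of_int ((\<lambda>b. if b = x then 1 else 0) \<beta>) *\<^sub>R \<beta>) = (\<Sum>\<beta>\<in>S. if \<beta> = x then \<beta> else 0)"
    by (rule sum.cong) auto
  also have "\<dots> = x" using assms by (simp add: sum.delta)
  finally show ?thesis by (intro int_spanI) (rule sym)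
qed

section \<open>Positive roots and simple reflections\<close>

locale based_root_system =
  fixes \<Phi> \<Delta> :: "'a::euclidean_space set"
  assumes root_system: "root_system \<Phi>" and simple_roots: "simple_roots \<Phi> \<Delta>"
begin

abbreviation pos :: "'a set" where "pos \<equiv> pos_roots \<Phi> \<Delta>"

definition coef :: "'a \<Rightarrow> 'a \<Rightarrow> real" where "coef b v = representation \<Delta> v b"

definition neg :: "'a \<Rightarrow> real" where "neg \<eta> = (if \<eta> \<in> pos then 0 else 1)"

lemma finite_roots: "finite \<Phi>" and zero_not_root: "0 \<notin> \<Phi>" and span_roots: "span \<Phi> = UNIV"
  and root_refl_root: "\<beta> \<in> \<Phi> \<Longrightarrow> \<eta> \<in> \<Phi> \<Longrightarrow> root_refl \<beta> \<eta> \<in> \<Phi>"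
  and coroot_integral: "\<beta> \<in> \<Phi> \<Longrightarrow> \<eta> \<in> \<Phi> \<Longrightarrow> coroot \<beta> \<bullet> \<eta> \<in> \<int>"
  and root_multiple: "\<beta> \<in> \<Phi> \<Longrightarrow> c *\<^sub>R \<beta> \<in> \<Phi> \<Longrightarrow> c = 1 \<or> c = -1"
  using root_system unfolding root_system_def by blast+

lemma simple_subset: "\<Delta> \<subseteq> \<Phi>" and independent_simple: "independent \<Delta>"
  and root_sign: "\<eta> \<in> \<Phi> \<Longrightarrow> \<eta> \<in> nat_span \<Delta> \<or> - \<eta> \<in> nat_span \<Delta>"
  using simple_roots unfolding simple_roots_def by blast+

lemma simple_root: "b \<in> \<Delta> \<Longrightarrow> b \<in> \<Phi>"
  using simple_subset by blast

lemma finite_simple: "finite \<Delta>"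
  using finite_roots simple_subset finite_subset by blast

lemma root_minus: "\<eta> \<in> \<Phi> \<Longrightarrow> - \<eta> \<in> \<Phi>"
  using root_refl_root[of \<eta> \<eta>] zero_not_root by (metis root_refl_self)

lemma finite_pos: "finite pos"
  using finite_roots by (simp add: pos_roots_def)

lemma pos_root: "\<eta> \<in> pos \<Longrightarrow> \<eta> \<in> \<Phi>"
  by (simp add: pos_roots_def)

lemma span_simple: "span \<Delta> = UNIV"
proof -
  have nat: "x \<in> span \<Delta>" if "x \<in> nat_span \<Delta>" for x
    using that unfolding nat_span_def by (auto intro: span_sum span_scale span_base)
  have "\<Phi> \<subseteq> span \<Delta>"
    using root_sign nat span_neg by (metis minus_minus subsetI)
  then have "span \<Phi> \<subseteq> span \<Delta>" by (simp add: span_minimal)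
  then show ?thesis using span_roots by auto
qed

lemma coef_add: "coef b (x + y) = coef b x + coef b y"
  and coef_scale: "coef b (c *\<^sub>R x) = c * coef b x"
  and coef_uminus: "coef b (- x) = - coef b x"
  and coef_diff: "coef b (x - y) = coef b x - coef b y"
  by (simp_all add: coef_def span_simple independent_simple
      representation_add representation_scale representation_neg representation_diff)

lemmas coef_simps = coef_add coef_scale coef_uminus coef_diff

lemma coef_simple: "b \<in> \<Delta> \<Longrightarrow> coef c b = (if c = b then 1 else 0)"
  by (simp add: coef_def representation_basis independent_simple)

lemma coef_expansion: "(\<Sum>b\<in>\<Delta>. coef b v *\<^sub>R b) = v"
  unfolding coef_def
  by (rule sum_representation_eq) (auto simp: independent_simple span_simple finite_simple)

lemma coef_eqI: "(\<And>b. b \<in> \<Delta> \<Longrightarrow> coef b x = coef b y) \<Longrightarrow> x = y"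
  using coef_expansion[of x] coef_expansion[of y] by (metis (no_types, lifting) sum.cong)

lemma coef_sum: "coef c (\<Sum>x\<in>S. f x) = (\<Sum>x\<in>S. coef c (f x))"
  by (simp add: coef_def representation_sum independent_simple span_simple)

lemma coef_combination:
  assumes "K \<subseteq> \<Delta>"
  shows "coef c (\<Sum>b\<in>K. f b *\<^sub>R b) = (if c \<in> K then f c else 0)"
proof -
  have "coef c (\<Sum>b\<in>K. f b *\<^sub>R b) = (\<Sum>b\<in>K. if c = b then f b else 0)"
    unfolding coef_sum coef_scale using assms by (intro sum.cong) (auto simp: coef_simple)
  also have "\<dots> = (if c \<in> K then f c else 0)"
    using finite_subset[OF assms finite_simple] by simp
  finally show ?thesis .
qed

lemma nat_span_iff: "v \<in> nat_span \<Delta> \<longleftrightarrow> (\<forall>b\<in>\<Delta>. coef b v \<in> \<nat>)"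
proof
  assume "v \<in> nat_span \<Delta>"
  then show "\<forall>b\<in>\<Delta>. coef b v \<in> \<nat>"
    by (auto simp: nat_span_def coef_combination)
next
  assume "\<forall>b\<in>\<Delta>. coef b v \<in> \<nat>"
  then have "\<forall>b\<in>\<Delta>. \<exists>n. coef b v = of_nat n" by (auto elim: Nats_cases)
  from bchoice[OF this] obtain c where c: "\<And>b. b \<in> \<Delta> \<Longrightarrow> coef b v = of_nat (c b)"
    by blast
  have "v = (\<Sum>b\<in>\<Delta>. coef b v *\<^sub>R b)" by (rule coef_expansion[symmetric])
  also have "\<dots> = (\<Sum>b\<in>\<Delta>. of_nat (c b) *\<^sub>R b)" by (rule sum.cong) (simp_all add: c)
  finally show "v \<in> nat_span \<Delta>" unfolding nat_span_def by blast
qed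

lemma int_span_iff:
  assumes "K \<subseteq> \<Delta>"
  shows "v \<in> int_span K \<longleftrightarrow> (\<forall>b\<in>\<Delta>. coef b v \<in> \<int>) \<and> (\<forall>b\<in>\<Delta> - K. coef b v = 0)"
proof
  assume "v \<in> int_span K"
  then show "(\<forall>b\<in>\<Delta>. coef b v \<in> \<int>) \<and> (\<forall>b\<in>\<Delta> - K. coef b v = 0)"
    by (auto simp: int_span_def coef_combination assms)
next
  assume *: "(\<forall>b\<in>\<Delta>. coef b v \<in> \<int>) \<and> (\<forall>b\<in>\<Delta> - K. coef b v = 0)"
  then have "\<forall>b\<in>\<Delta>. \<exists>n. coef b v = of_int n" unfolding Ints_def by blast
  from bchoice[OF this] obtain c where c: "\<And>b. b \<in> \<Delta> \<Longrightarrow> coef b v = of_int (c b)"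
    by blast
  have "v = (\<Sum>b\<in>\<Delta>. coef b v *\<^sub>R b)" by (rule coef_expansion[symmetric])
  also have "\<dots> = (\<Sum>b\<in>K. coef b v *\<^sub>R b)"
    using * assms by (intro sum.mono_neutral_right finite_simple) auto
  also have "\<dots> = (\<Sum>b\<in>K. of_int (c b) *\<^sub>R b)"
    using assms by (intro sum.cong) (auto simp: c)
  finally show "v \<in> int_span K" by (rule int_spanI)
qed

lemma root_coef_integral:
  assumes "\<eta> \<in> \<Phi>" "b \<in> \<Delta>"
  shows "coef b \<eta> \<in> \<int>"
proof -
  have "coef b \<eta> \<in> \<nat> \<or> - coef b \<eta> \<in> \<nat>"
    using root_sign[OF assms(1)] assms(2) by (auto simp: nat_span_iff coef_uminus)
  then show ?thesis by (metis Nats_subset_Ints subsetD minus_in_Ints_iff)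
qed

lemma pos_iff:
  assumes "\<eta> \<in> \<Phi>"
  shows "\<eta> \<in> pos \<longleftrightarrow> (\<forall>b\<in>\<Delta>. coef b \<eta> \<ge> 0)"
  using assms root_coef_integral[OF assms]
  by (auto simp: pos_roots_def nat_span_iff Nats_altdef2)

lemma pos_coef: "\<eta> \<in> pos \<Longrightarrow> b \<in> \<Delta> \<Longrightarrow> coef b \<eta> \<ge> 0"
  using pos_iff pos_root by blast

lemma simple_pos: "b \<in> \<Delta> \<Longrightarrow> b \<in> pos"
  using simple_root by (simp add: pos_iff coef_simple)

lemma pos_or_minus_pos: "\<eta> \<in> \<Phi> \<Longrightarrow> \<eta> \<notin> pos \<Longrightarrow> - \<eta> \<in> pos"
  using root_sign[of \<eta>] root_minus[of \<eta>] by (auto simp: pos_roots_def)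

lemma root_nonzero_coef:
  assumes "\<eta> \<in> \<Phi>"
  obtains b where "b \<in> \<Delta>" "coef b \<eta> \<noteq> 0"
proof -
  have "\<eta> \<noteq> 0" using assms zero_not_root by blast
  then show ?thesis using coef_eqI[of \<eta> 0] coef_scale[of _ 0 0] that by fastforce
qed

lemma not_pos_minus: "\<eta> \<in> pos \<Longrightarrow> - \<eta> \<notin> pos"
  by (metis coef_uminus neg_0_le_iff_le order_antisym pos_coef pos_root root_nonzero_coef)

lemma pos_if_coef_pos: "\<eta> \<in> \<Phi> \<Longrightarrow> b \<in> \<Delta> \<Longrightarrow> coef b \<eta> > 0 \<Longrightarrow> \<eta> \<in> pos"
  using pos_or_minus_pos[of \<eta>] pos_coef[of "- \<eta>" b] by (auto simp: coef_uminus)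

lemma neg_minus: "\<eta> \<in> \<Phi> \<Longrightarrow> neg (- \<eta>) = 1 - neg \<eta>"
  using pos_or_minus_pos[of \<eta>] not_pos_minus[of \<eta>] by (auto simp: neg_def)

lemma weyl_root: "w \<in> weyl_group K \<Longrightarrow> K \<subseteq> \<Phi> \<Longrightarrow> \<eta> \<in> \<Phi> \<Longrightarrow> w \<eta> \<in> \<Phi>"
  by (induction arbitrary: \<eta> rule: weyl_group_induct) (auto intro: root_refl_root)

lemma coef_refl: "a \<in> \<Delta> \<Longrightarrow> b \<noteq> a \<Longrightarrow> coef b (root_refl a v) = coef b v"
  by (simp add: root_refl_def coef_simps coef_simple)

text \<open>A simple reflection changes a single coefficient, so a positive root with a second simple
  root in its support stays positive; by reducedness only the simple root itself has none.\<close>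

lemma simple_refl_pos:
  assumes "a \<in> \<Delta>" "\<beta> \<in> pos" "\<beta> \<noteq> a"
  shows "root_refl a \<beta> \<in> pos"
proof -
  have "\<exists>b\<in>\<Delta> - {a}. coef b \<beta> \<noteq> 0"
  proof (rule ccontr)
    assume *: "\<not> ?thesis"
    have eq: "\<beta> = coef a \<beta> *\<^sub>R a"
      by (rule coef_eqI) (use * assms in \<open>auto simp: coef_scale coef_simple\<close>)
    then have "coef a \<beta> = 1 \<or> coef a \<beta> = -1"
      using root_multiple[of a "coef a \<beta>"] assms simple_root pos_root by metis
    moreover have "coef a \<beta> \<ge> 0" using assms pos_coef by blast
    ultimately show False using eq assms(3) by auto
  qed
  then obtain b where b: "b \<in> \<Delta>" "b \<noteq> a" "coef b \<beta> \<noteq> 0" by blast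
  then have "coef b (root_refl a \<beta>) > 0"
    using pos_coef[OF assms(2) b(1)] assms(1) by (simp add: coef_refl)
  then show ?thesis
    using b assms by (meson pos_if_coef_pos pos_root root_refl_root simple_root)
qed

text \<open>Induction on the height: a positive root that is not simple has a positive inner product
  with a simple root in its support, and reflecting in that simple root lowers the height.\<close>

lemma refl_in_weyl_group:
  assumes "K \<subseteq> \<Delta>" "\<eta> \<in> pos" "\<forall>b\<in>\<Delta> - K. coef b \<eta> = 0"
  shows "root_refl \<eta> \<in> weyl_group K"
  using assms(2,3)
proof (induction \<eta> rule: measure_induct_rule[where f = "\<lambda>\<eta>. nat \<lfloor>\<Sum>b\<in>\<Delta>. coef b \<eta>\<rfloor>"])
  case (less \<eta>)
  have "\<eta> \<noteq> 0" using less.prems(1) pos_root zero_not_root by blast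
  then have "0 < \<eta> \<bullet> \<eta>" by simp
  also have "\<eta> \<bullet> \<eta> = (\<Sum>b\<in>\<Delta>. coef b \<eta> * (b \<bullet> \<eta>))"
    by (subst (1) coef_expansion[of \<eta>, symmetric]) (simp add: inner_sum_left)
  finally have "\<not> (\<Sum>b\<in>\<Delta>. coef b \<eta> * (b \<bullet> \<eta>)) \<le> 0" by simp
  then obtain b where b: "b \<in> \<Delta>" "coef b \<eta> * (b \<bullet> \<eta>) > 0"
    using sum_nonpos[of \<Delta> "\<lambda>b. coef b \<eta> * (b \<bullet> \<eta>)"] by force
  then have cb: "b \<bullet> \<eta> > 0" "coef b \<eta> > 0"
    using pos_coef[OF less.prems(1) b(1)] by (auto simp: zero_less_mult_iff)
  then have bK: "b \<in> K" using less.prems(2) b(1) by force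
  show ?case
  proof (cases "\<eta> = b")
    case True
    then show ?thesis using bK by (simp add: weyl_group_refl)
  next
    case False
    let ?k = "coroot b \<bullet> \<eta>" and ?\<eta>' = "root_refl b \<eta>"
    have pos': "?\<eta>' \<in> pos" using simple_refl_pos b(1) less.prems(1) False by blast
    have "b \<noteq> 0" using b(1) simple_root zero_not_root by blast
    then have "?k > 0" using cb(1) by (simp add: coroot_def)
    moreover have "?k \<in> \<int>" using coroot_integral simple_root[OF b(1)] pos_root[OF less.prems(1)] by blast
    ultimately have k: "?k \<ge> 1" by (auto simp: Ints_def)
    have "(\<Sum>c\<in>\<Delta>. coef c ?\<eta>') = (\<Sum>c\<in>\<Delta>. coef c \<eta> - ?k * (if c = b then 1 else 0))"
      by (rule sum.cong) (simp_all add: root_refl_def coef_simps coef_simple b(1))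
    also have "\<dots> = (\<Sum>c\<in>\<Delta>. coef c \<eta>) - ?k"
      using b(1) finite_simple by (simp add: sum_subtractf flip: sum_distrib_left)
    finally have h: "(\<Sum>c\<in>\<Delta>. coef c ?\<eta>') = (\<Sum>c\<in>\<Delta>. coef c \<eta>) - ?k" .
    have "(\<Sum>c\<in>\<Delta>. coef c ?\<eta>') \<ge> 0" by (rule sum_nonneg) (rule pos_coef[OF pos'])
    then have "nat \<lfloor>\<Sum>c\<in>\<Delta>. coef c ?\<eta>'\<rfloor> < nat \<lfloor>\<Sum>c\<in>\<Delta>. coef c \<eta>\<rfloor>"
      using h k by linarith
    moreover have "\<forall>c\<in>\<Delta> - K. coef c ?\<eta>' = 0"
    proof
      fix c assume c: "c \<in> \<Delta> - K"
      then have "c \<noteq> b" using bK by blast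
      then show "coef c ?\<eta>' = 0" using less.prems(2) b(1) c by (simp add: coef_refl)
    qed
    ultimately have "root_refl ?\<eta>' \<in> weyl_group K" using less.IH pos' by blast
    then have "root_refl b \<circ> root_refl ?\<eta>' \<circ> root_refl b \<in> weyl_group K"
      using weyl_group_comp weyl_group_refl[OF bK] by blast
    also have "root_refl b \<circ> root_refl ?\<eta>' \<circ> root_refl b = root_refl \<eta>"
      by (simp only: comp_assoc root_refl_conjugate[OF root_refl_orthogonal] root_refl_comp_cancel)
    finally show ?thesis .
  qed
qed

section \<open>Length and inversions\<close>

abbreviation W :: "('a \<Rightarrow> 'a) set" where "W \<equiv> weyl_group \<Delta>"
abbreviation len :: "('a \<Rightarrow> 'a) \<Rightarrow> nat" where "len \<equiv> weyl_length \<Delta>"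

definition inversions :: "'a set \<Rightarrow> ('a \<Rightarrow> 'a) \<Rightarrow> 'a set" where
  "inversions S w = {\<beta> \<in> S. w \<beta> \<notin> pos}"

lemma W_root: "w \<in> W \<Longrightarrow> \<eta> \<in> \<Phi> \<Longrightarrow> w \<eta> \<in> \<Phi>"
  using weyl_root simple_subset by blast

lemma refl_in_W: "\<eta> \<in> \<Phi> \<Longrightarrow> root_refl \<eta> \<in> W"
  using refl_in_weyl_group[of \<Delta> \<eta>] refl_in_weyl_group[of \<Delta> "- \<eta>"] pos_or_minus_pos[of \<eta>] by auto

lemma len_le: "set as \<subseteq> \<Delta> \<Longrightarrow> len (word_prod as) \<le> length as"
  unfolding weyl_length_def by (rule Least_le) auto

lemma reduced_word:
  assumes "w \<in> W"
  obtains as where "set as \<subseteq> \<Delta>" "length as = len w" "word_prod as = w"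
proof -
  have "\<exists>n as. set as \<subseteq> \<Delta> \<and> length as = n \<and> word_prod as = w"
    using assms by (auto simp: weyl_group_def)
  from LeastI_ex[OF this] show ?thesis using that unfolding weyl_length_def by auto
qed

text \<open>The strong exchange property.  Applying the letters of the word to \<open>\<gamma>\<close> from the right, the
  image turns negative at some letter; just before, it must be the simple root of that letter,
  and multiplying by the reflection in \<open>\<gamma>\<close> deletes the letter.\<close>

lemma strong_exchange:
  assumes "set as \<subseteq> \<Delta>" "\<gamma> \<in> pos" "word_prod as \<gamma> \<notin> pos"
  shows "\<exists>bs. set bs \<subseteq> \<Delta> \<and> length bs < length as \<and> word_prod bs = word_prod as \<circ> root_refl \<gamma>"
  using assms(1,3)
proof (induction as)
  case Nil
  then show ?case using assms(2) by simp
next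
  case (Cons a as)
  show ?case
  proof (cases "word_prod as \<gamma> \<in> pos")
    case True
    then have "word_prod as \<gamma> = a"
      using simple_refl_pos[of a "word_prod as \<gamma>"] Cons.prems by auto
    moreover have "orthogonal_transformation (word_prod as)"
      using weyl_group_orthogonal[OF weyl_groupI] Cons.prems by auto
    ultimately have "root_refl a \<circ> word_prod as = word_prod as \<circ> root_refl \<gamma>"
      using root_refl_conjugate by blast
    then have "word_prod (a # as) \<circ> root_refl \<gamma> = word_prod as"
      by (simp only: word_prod_Cons root_refl_comp_cancel_right)
    moreover have "set as \<subseteq> \<Delta>" "length as < length (a # as)" using Cons.prems by auto
    ultimately show ?thesis by metis
  next
    case False
    moreover have "set as \<subseteq> \<Delta>" using Cons.prems by simp
    ultimately obtain bs where bs: "set bs \<subseteq> \<Delta>" "length bs < length as"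
      "word_prod bs = word_prod as \<circ> root_refl \<gamma>" using Cons.IH by blast
    then have "word_prod (a # bs) = word_prod (a # as) \<circ> root_refl \<gamma>"
      by (simp only: word_prod_Cons comp_assoc)
    moreover have "set (a # bs) \<subseteq> \<Delta>" "length (a # bs) < length (a # as)" 
      using bs Cons.prems by auto
    ultimately show ?thesis by blast
  qed
qed

lemma len_refl_less:
  assumes "w \<in> W" "\<gamma> \<in> pos" "w \<gamma> \<notin> pos"
  shows "len (w \<circ> root_refl \<gamma>) < len w"
proof -
  obtain as where as: "set as \<subseteq> \<Delta>" "length as = len w" "word_prod as = w"
    using reduced_word[OF assms(1)] by blast
  then obtain bs where "set bs \<subseteq> \<Delta>" "length bs < len w" "word_prod bs = w \<circ> root_refl \<gamma>"
    using strong_exchange[OF as(1) assms(2)] assms(3) by auto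
  then show ?thesis using len_le[of bs] by simp
qed

lemma inversions_simple:
  assumes w: "w \<in> W" and a: "a \<in> \<Delta>" "w a \<in> pos"
  shows "inversions pos (w \<circ> root_refl a) = insert a (root_refl a ` inversions pos w)"
    and "a \<notin> root_refl a ` inversions pos w"
proof -
  have refl_a: "root_refl a a = - a" 
    using a(1) simple_root zero_not_root by (metis root_refl_self)
  have notpos: "w (- a) \<notin> pos" using not_pos_minus a(2) by (simp add: weyl_group_minus[OF w])
  show "a \<notin> root_refl a ` inversions pos w"
  proof
    assume "a \<in> root_refl a ` inversions pos w"
    then obtain \<beta> where "\<beta> \<in> pos" "a = root_refl a \<beta>" by (auto simp: inversions_def)
    then have "\<beta> = - a" by (metis refl_a root_refl_involution)
    then show False using \<open>\<beta> \<in> pos\<close> not_pos_minus simple_pos a(1) by blast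
  qed
  show "inversions pos (w \<circ> root_refl a) = insert a (root_refl a ` inversions pos w)"
  proof (intro set_eqI iffI)
    fix \<beta> assume "\<beta> \<in> inversions pos (w \<circ> root_refl a)"
    then have \<beta>: "\<beta> \<in> pos" "w (root_refl a \<beta>) \<notin> pos" by (auto simp: inversions_def)
    show "\<beta> \<in> insert a (root_refl a ` inversions pos w)"
    proof (cases "\<beta> = a")
      case False
      then have "root_refl a \<beta> \<in> inversions pos w"
        using simple_refl_pos a(1) \<beta> by (simp add: inversions_def)
      then show ?thesis by (metis imageI insertCI root_refl_involution)
    qed simp
  next
    fix \<beta> assume "\<beta> \<in> insert a (root_refl a ` inversions pos w)"
    then consider "\<beta> = a" | \<eta> where "\<eta> \<in> pos" "w \<eta> \<notin> pos" "\<beta> = root_refl a \<eta>"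
      by (auto simp: inversions_def)
    then show "\<beta> \<in> inversions pos (w \<circ> root_refl a)"
    proof cases
      case 1
      then show ?thesis using notpos simple_pos[OF a(1)] by (simp add: inversions_def refl_a)
    next
      case 2
      then have "\<eta> \<noteq> a" using a(2) by auto
      then have "\<beta> \<in> pos" using 2 simple_refl_pos a(1) by blast
      then show ?thesis using 2 by (simp add: inversions_def)
    qed
  qed
qed

text \<open>Induction along a reduced word: appending a letter \<open>a\<close> that increases the length means that
  \<open>a\<close> is not inverted before, and then exactly one inversion is added.\<close>

lemma len_eq_card_inversions: "w \<in> W \<Longrightarrow> len w = card (inversions pos w)"
proof (induction "len w" arbitrary: w)
  case 0
  then obtain as where "length as = 0" "word_prod as = w"
    using reduced_word[of w] 0 by metis
  then have "w = id" by (metis length_0_conv word_prod_Nil)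
  then have "inversions pos w = {}" by (auto simp: inversions_def)
  then show ?case using 0 by simp
next
  case (Suc n)
  then obtain as where as: "set as \<subseteq> \<Delta>" "length as = Suc n" "word_prod as = w"
    using reduced_word[of w] Suc by metis
  then obtain bs a where bs: "as = bs @ [a]" by (cases as rule: rev_cases) auto
  define v where "v = word_prod bs"
  have set: "set bs \<subseteq> \<Delta>" "a \<in> \<Delta>" and lbs: "length bs = n" using as bs by auto
  have v: "v \<in> W" using set by (simp add: v_def weyl_groupI)
  have app: "word_prod (cs @ [a]) = word_prod cs \<circ> root_refl a" for cs
    by (simp only: word_prod_append word_prod_Cons word_prod_Nil comp_id)
  have w: "w = v \<circ> root_refl a" using as(3) app[of bs] bs v_def by metis
  have "len v \<le> n" using len_le[of bs] set lbs by (simp add: v_def)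
  moreover have "len w \<le> Suc (len v)"
  proof -
    obtain cs where cs: "set cs \<subseteq> \<Delta>" "length cs = len v" "word_prod cs = v"
      using reduced_word[OF v] by blast
    have "w = word_prod (cs @ [a])" using w app cs(3) by metis
    then show ?thesis using len_le[of "cs @ [a]"] cs set(2) by simp
  qed
  ultimately have lv: "len v = n" using Suc.hyps(2) by linarith
  have "v a \<in> pos"
  proof (rule ccontr)
    assume "v a \<notin> pos"
    then have "len w < len v" using len_refl_less[OF v simple_pos[OF set(2)]] w by simp
    then show False using lv Suc.hyps(2) by linarith
  qed
  note inv = inversions_simple[OF v set(2) this]
  have "finite (inversions pos v)" by (simp add: inversions_def finite_pos)
  moreover have "inj (root_refl a)"
    by (metis injI root_refl_involution)
  ultimately have "card (inversions pos w) = Suc (card (inversions pos v))"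
    unfolding w inv(1) using inv(2) by (simp add: card_image inj_on_subset)
  then show ?case using Suc.hyps(1)[of v] lv v Suc.hyps(2) by simp
qed

end

section \<open>Parabolic length\<close>

locale parabolic_root_system = based_root_system +
  fixes J :: "'a set"
  assumes J_subset: "J \<subseteq> \<Delta>"
begin

abbreviation posJ :: "'a set" where "posJ \<equiv> pos_roots_sub \<Phi> \<Delta> J"
abbreviation outer :: "'a set" where "outer \<equiv> pos - posJ"
abbreviation WJ :: "('a \<Rightarrow> 'a) set" where "WJ \<equiv> weyl_group J"
abbreviation reps :: "('a \<Rightarrow> 'a) set" where "reps \<equiv> min_reps \<Delta> J"
abbreviation fl :: "('a \<Rightarrow> 'a) \<Rightarrow> ('a \<Rightarrow> 'a)" where "fl \<equiv> min_rep \<Delta> J"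

lemma posJ_iff: "\<eta> \<in> posJ \<longleftrightarrow> \<eta> \<in> pos \<and> (\<forall>b\<in>\<Delta> - J. coef b \<eta> = 0)"
  using int_span_iff[OF J_subset, of \<eta>] root_coef_integral[of \<eta>] pos_root[of \<eta>]
  by (auto simp: pos_roots_sub_def)

lemma outer_iff: "\<eta> \<in> outer \<longleftrightarrow> \<eta> \<in> \<Phi> \<and> (\<exists>b\<in>\<Delta> - J. coef b \<eta> > 0)"
proof
  assume "\<eta> \<in> outer"
  then have "\<eta> \<in> pos" and "\<exists>b\<in>\<Delta> - J. coef b \<eta> \<noteq> 0" by (auto simp: posJ_iff)
  then show "\<eta> \<in> \<Phi> \<and> (\<exists>b\<in>\<Delta> - J. coef b \<eta> > 0)"
    using pos_root[of \<eta>] pos_coef[of \<eta>] by force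
next
  assume "\<eta> \<in> \<Phi> \<and> (\<exists>b\<in>\<Delta> - J. coef b \<eta> > 0)"
  then show "\<eta> \<in> outer" using pos_if_coef_pos[of \<eta>] by (force simp: posJ_iff)
qed

lemma outer_pos: "\<eta> \<in> outer \<Longrightarrow> \<eta> \<in> pos"
  and outer_root: "\<eta> \<in> outer \<Longrightarrow> \<eta> \<in> \<Phi>"
  using pos_root by auto

lemma finite_outer: "finite outer"
  using finite_pos by simp

lemma outer_not_minus: "\<eta> \<in> outer \<Longrightarrow> - \<eta> \<notin> outer"
  using not_pos_minus outer_pos by blast

lemma posJ_refl: "\<eta> \<in> posJ \<Longrightarrow> root_refl \<eta> \<in> WJ"
  using refl_in_weyl_group[OF J_subset, of \<eta>] by (simp add: posJ_iff)

lemma outer_refl: "\<eta> \<in> outer \<Longrightarrow> root_refl \<eta> \<in> W"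
  using refl_in_W outer_root by blast

lemma WJ_W: "u \<in> WJ \<Longrightarrow> u \<in> W"
  using weyl_group_mono[OF J_subset] by blast

lemma coef_WJ: "u \<in> WJ \<Longrightarrow> b \<in> \<Delta> - J \<Longrightarrow> coef b (u v) = coef b v"
proof (induction rule: weyl_group_induct)
  case id
  then show ?case by simp
next
  case (refl a w)
  then have "a \<in> \<Delta>" "b \<noteq> a" using J_subset by auto
  then have "coef b (root_refl a (w v)) = coef b (w v)" by (rule coef_refl)
  then show ?case using refl by simp
qed

lemma outer_WJ: "u \<in> WJ \<Longrightarrow> \<eta> \<in> outer \<Longrightarrow> u \<eta> \<in> outer"
  using W_root[OF WJ_W, of u \<eta>] coef_WJ[of u] unfolding outer_iff by auto

lemma outer_WJ_iff:
  assumes "u \<in> WJ"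
  shows "u \<eta> \<in> outer \<longleftrightarrow> \<eta> \<in> outer"
proof
  assume "u \<eta> \<in> outer"
  then have "inv u (u \<eta>) \<in> outer" by (rule outer_WJ[OF weyl_group_inv[OF assms]])
  then show "\<eta> \<in> outer" by (simp only: weyl_inv_apply[OF assms])
qed (rule outer_WJ[OF assms])

lemma bij_outer_WJ:
  assumes "u \<in> WJ"
  shows "bij_betw u outer outer"
proof (rule bij_betw_byWitness[where f' = "inv u"])
  show "u ` outer \<subseteq> outer" using outer_WJ[OF assms] by blast
  show "inv u ` outer \<subseteq> outer" using outer_WJ[OF weyl_group_inv[OF assms]] by blast
qed (simp_all add: weyl_inv_apply[OF assms])

text \<open>The length of the minimal representative of \<open>v W\<^sub>J\<close>, as a count of inversions: \<open>W\<^sub>J\<close> permutes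
  the positive roots outside \<open>\<Phi>\<^sub>J\<close>, so the count depends on the coset only, and a minimal
  representative has no other inversions.  It is real-valued for the sake of the pairings with
  \<open>2\<rho> - 2\<rho>\<^sub>J\<close>.\<close>

definition plen :: "('a \<Rightarrow> 'a) \<Rightarrow> real" where
  "plen v = (\<Sum>\<beta>\<in>outer. neg (v \<beta>))"

lemma plen_card: "plen v = real (card (inversions outer v))"
proof -
  have "plen v = (\<Sum>\<beta>\<in>outer. if \<beta> \<in> {\<beta>. v \<beta> \<notin> pos} then 1 else 0)"
    unfolding plen_def by (rule sum.cong) (simp_all add: neg_def)
  also have "\<dots> = real (card (outer \<inter> {\<beta>. v \<beta> \<notin> pos}))"
    using finite_outer by (simp add: sum.If_cases)
  also have "outer \<inter> {\<beta>. v \<beta> \<notin> pos} = inversions outer v"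
    by (auto simp: inversions_def)
  finally show ?thesis .
qed

lemma plen_WJ:
  assumes "u \<in> WJ"
  shows "plen (v \<circ> u) = plen v"
  unfolding plen_def comp_apply
  by (rule sum.reindex_bij_betw[OF bij_outer_WJ[OF assms], of "\<lambda>\<beta>. neg (v \<beta>)"])

lemma plen_le: "v \<in> W \<Longrightarrow> plen v \<le> len v"
  unfolding plen_card len_eq_card_inversions of_nat_le_iff
  by (rule card_mono) (auto simp: inversions_def finite_pos)

lemma plen_eq_len:
  assumes "w \<in> W" "\<forall>\<beta>\<in>posJ. w \<beta> \<in> pos"
  shows "plen w = len w"
proof -
  have "inversions outer w = inversions pos w"
    using assms(2) by (auto simp: inversions_def)
  then show ?thesis by (simp add: plen_card len_eq_card_inversions assms(1))
qed

lemma reps_W: "w \<in> reps \<Longrightarrow> w \<in> W"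
  by (simp add: min_reps_def)

text \<open>Reflections in roots of \<open>\<Phi>\<^sub>J\<close> stay in the coset, so a minimal representative cannot invert such
  a root.  Conversely, if \<open>w\<close> inverts none, its length is the number of its inversions outside
  \<open>\<Phi>\<^sub>J\<close>, and all elements of the coset have as many of these.\<close>

lemma reps_iff: "w \<in> reps \<longleftrightarrow> w \<in> W \<and> (\<forall>\<beta>\<in>posJ. w \<beta> \<in> pos)"
proof
  assume w: "w \<in> reps"
  have "w \<beta> \<in> pos" if \<beta>: "\<beta> \<in> posJ" for \<beta>
  proof (rule ccontr)
    assume "w \<beta> \<notin> pos"
    then have "len (w \<circ> root_refl \<beta>) < len w"
      using len_refl_less[OF reps_W[OF w], of \<beta>] \<beta> posJ_iff by blast
    moreover have "w \<circ> root_refl \<beta> \<in> lcoset J w"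
      using posJ_refl[OF \<beta>] lcoset_iff by blast
    ultimately show False using w by (force simp: min_reps_def)
  qed
  then show "w \<in> W \<and> (\<forall>\<beta>\<in>posJ. w \<beta> \<in> pos)" using reps_W[OF w] by blast
next
  assume w: "w \<in> W \<and> (\<forall>\<beta>\<in>posJ. w \<beta> \<in> pos)"
  have "len w \<le> len x" if "x \<in> lcoset J w" for x
  proof -
    obtain u where u: "u \<in> WJ" "x = w \<circ> u" using \<open>x \<in> lcoset J w\<close> lcoset_iff by blast
    then have "real (len w) = plen x" using w plen_eq_len[of w] plen_WJ[of u w] by metis
    also have "\<dots> \<le> len x" using u w weyl_group_comp WJ_W plen_le by blast
    finally show ?thesis by simp
  qed
  then show "w \<in> reps" using w by (simp add: min_reps_def)
qed

lemma reps_len: "w \<in> reps \<Longrightarrow> real (len w) = plen w"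
  using plen_eq_len reps_iff by metis

text \<open>Since both \<open>w\<close> and \<open>w u\<close> keep the positive roots of \<open>\<Phi>\<^sub>J\<close> positive, so does \<open>u\<close>,
  which then has no inversions at all.\<close>

lemma reps_unique:
  assumes w: "w \<in> reps" and u: "u \<in> WJ" and wu: "w \<circ> u \<in> reps"
  shows "u = id"
proof -
  have "u \<beta> \<in> pos" if \<beta>: "\<beta> \<in> pos" for \<beta>
  proof (cases "\<beta> \<in> posJ")
    case False
    then show ?thesis using outer_WJ[OF u, of \<beta>] \<beta> by blast
  next
    case True
    show ?thesis
    proof (rule ccontr)
      assume "u \<beta> \<notin> pos"
      then have "- u \<beta> \<in> pos" using pos_or_minus_pos W_root[OF WJ_W[OF u]] pos_root \<beta> by blast
      moreover have "\<forall>b\<in>\<Delta> - J. coef b (- u \<beta>) = 0"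
        using True coef_WJ[OF u] by (simp add: coef_uminus posJ_iff)
      ultimately have "w (- u \<beta>) \<in> pos" using w reps_iff posJ_iff by blast
      then have "w (u \<beta>) \<notin> pos"
        using not_pos_minus weyl_group_minus[OF reps_W[OF w]] by (metis minus_minus)
      moreover have "(w \<circ> u) \<beta> \<in> pos" using wu True reps_iff by blast
      ultimately show False by simp
    qed
  qed
  then have "inversions pos u = {}" by (auto simp: inversions_def)
  then have "len u = 0" by (simp add: len_eq_card_inversions WJ_W[OF u])
  then obtain as where "length as = 0" "word_prod as = u"
    using reduced_word[OF WJ_W[OF u]] by metis
  then show ?thesis by (metis length_0_conv word_prod_Nil)
qed

lemma fl_lcoset: "fl w \<in> lcoset J w"
  and fl_minimal: "x \<in> lcoset J w \<Longrightarrow> len (fl w) \<le> len x"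
proof -
  have w: "w \<in> lcoset J w" unfolding lcoset_iff by (rule bexI[of _ id]) auto
  have "fl w \<in> lcoset J w \<and> (\<forall>x. x \<in> lcoset J w \<longrightarrow> len (fl w) \<le> len x)"
    unfolding min_rep_def arg_min_on_def using arg_min_nat_lemma[of "\<lambda>x. x \<in> lcoset J w" w len] w by blast
  then show "fl w \<in> lcoset J w" "x \<in> lcoset J w \<Longrightarrow> len (fl w) \<le> len x" by blast+
qed

lemma fl_reps:
  assumes "w \<in> W"
  shows "fl w \<in> reps"
proof -
  obtain u where u: "u \<in> WJ" "fl w = w \<circ> u" using fl_lcoset lcoset_iff by blast
  then have "fl w \<in> W" using assms weyl_group_comp WJ_W by metis
  moreover have "lcoset J (fl w) = lcoset J w" using u lcoset_comp by metis
  ultimately show ?thesis using fl_minimal by (simp add: min_reps_def)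
qed

lemma fl_factor:
  obtains u where "u \<in> WJ" "w = fl w \<circ> u"
proof -
  obtain v where v: "v \<in> WJ" "fl w = w \<circ> v" using fl_lcoset lcoset_iff by blast
  have "fl w \<circ> inv v = w"
    by (simp only: v(2) comp_assoc weyl_inv_apply[OF v(1)] comp_id)
  then show ?thesis using that weyl_group_inv[OF v(1)] by metis
qed

lemma fl_comp: "u \<in> WJ \<Longrightarrow> fl (w \<circ> u) = fl w"
  unfolding min_rep_def by (simp only: lcoset_comp)

lemma fl_eq:
  assumes "x \<in> reps" "u \<in> WJ" "w = x \<circ> u"
  shows "fl w = x"
proof -
  have flx: "fl x \<in> reps" using assms(1) fl_reps reps_W by blast
  obtain v where v: "v \<in> WJ" "x = fl x \<circ> v" using fl_factor .
  then have "v = id" using reps_unique[OF flx v(1)] assms(1) by simp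
  then have "fl x = x" using v(2) by (metis comp_id)
  then show ?thesis using fl_comp[OF assms(2)] assms(3) by metis
qed

lemma fl_id: "x \<in> reps \<Longrightarrow> fl x = x"
  using fl_eq[OF _ weyl_group_id] by (metis comp_id)

lemma plen_fl: "plen (fl w) = plen w"
proof -
  obtain u where "u \<in> WJ" "fl w = w \<circ> u" using fl_lcoset lcoset_iff by blast
  then show ?thesis using plen_WJ by metis
qed

text \<open>With \<open>x\<close> the minimal representative of \<open>v r\<^sub>\<gamma> = x u\<close>, the element \<open>v u\<^sup>-\<^sup>1\<close> of the coset of \<open>v\<close>
  is the product of \<open>x\<close> with the reflection in \<open>u \<gamma>\<close>, a positive root that \<open>x\<close> inverts.  So the coset
  of \<open>v\<close> has an element shorter than \<open>x\<close>.\<close>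

lemma reflect_from_minimal:
  assumes v: "v \<in> W" and \<gamma>: "\<gamma> \<in> outer" and v\<gamma>: "v \<gamma> \<in> pos"
    and u: "u \<in> WJ" "v \<circ> root_refl \<gamma> = fl (v \<circ> root_refl \<gamma>) \<circ> u"
  defines "x' \<equiv> fl (v \<circ> root_refl \<gamma>) \<circ> root_refl (u \<gamma>)"
  shows "v = x' \<circ> u" "x' \<in> W" "real (len x') < plen (v \<circ> root_refl \<gamma>)"
proof -
  define x where "x = fl (v \<circ> root_refl \<gamma>)"
  have x: "x \<in> reps" unfolding x_def using v outer_refl[OF \<gamma>] by (intro fl_reps weyl_group_comp)
  have u\<gamma>: "u \<gamma> \<in> outer" using outer_WJ[OF u(1) \<gamma>] .
  have "x' \<circ> u = x \<circ> (root_refl (u \<gamma>) \<circ> u)" by (simp only: x'_def x_def comp_assoc)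
  also have "\<dots> = x \<circ> u \<circ> root_refl \<gamma>"
    by (simp only: root_refl_conjugate[OF weyl_group_orthogonal[OF u(1)]] comp_assoc)
  also have "\<dots> = v" 
    by (simp only: x_def u(2)[symmetric] root_refl_comp_cancel_right)
  finally show "v = x' \<circ> u" by (rule sym)
  show "x' \<in> W" unfolding x'_def x_def[symmetric]
    using reps_W[OF x] outer_refl[OF u\<gamma>] by (rule weyl_group_comp)
  have "\<gamma> \<noteq> 0" using outer_root[OF \<gamma>] zero_not_root by blast
  then have "x (u \<gamma>) = - v \<gamma>"
    using fun_cong[OF u(2), of \<gamma>] weyl_group_minus[OF v] by (simp add: x_def root_refl_self)
  then have "x (u \<gamma>) \<notin> pos" using not_pos_minus v\<gamma> by metis
  then have "len x' < len x"
    unfolding x'_def x_def[symmetric] using len_refl_less reps_W[OF x] outer_pos[OF u\<gamma>] by blast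
  then have "real (len x') < real (len x)" by simp
  also have "\<dots> = plen (v \<circ> root_refl \<gamma>)" using reps_len[OF x] by (simp only: x_def plen_fl)
  finally show "real (len x') < plen (v \<circ> root_refl \<gamma>)" .
qed

lemma plen_less:
  assumes "v \<in> W" "\<gamma> \<in> outer" "v \<gamma> \<in> pos"
  shows "plen v < plen (v \<circ> root_refl \<gamma>)"
proof -
  obtain u where u: "u \<in> WJ" "v \<circ> root_refl \<gamma> = fl (v \<circ> root_refl \<gamma>) \<circ> u" using fl_factor .
  note * = reflect_from_minimal[OF assms u]
  show ?thesis using *(1,3) plen_WJ[OF u(1)] plen_le[OF *(2)] by (metis order_le_less_trans)
qed

text \<open>If the minimal lengths of the two cosets differ by one only, the element of the coset of \<open>w\<close>
  found above is itself minimal, hence equal to \<open>w\<close>, and \<open>u\<close> is trivial.\<close>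

lemma cover_is_minimal:
  assumes w: "w \<in> reps" and \<gamma>: "\<gamma> \<in> outer" and w\<gamma>: "w \<gamma> \<in> pos"
    and cover: "plen (w \<circ> root_refl \<gamma>) = plen w + 1"
  shows "w \<circ> root_refl \<gamma> \<in> reps"
proof -
  have wW: "w \<in> W" using reps_W[OF w] .
  obtain u where u: "u \<in> WJ" "w \<circ> root_refl \<gamma> = fl (w \<circ> root_refl \<gamma>) \<circ> u" using fl_factor .
  define x' where "x' = fl (w \<circ> root_refl \<gamma>) \<circ> root_refl (u \<gamma>)"
  note * = reflect_from_minimal[OF wW \<gamma> w\<gamma> u, folded x'_def]
  have "len x' \<le> len w" using *(3) cover reps_len[OF w] by linarith
  moreover have "lcoset J w = lcoset J x'" using *(1) lcoset_comp[OF u(1)] by metis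
  ultimately have "x' \<in> reps" using w *(2) by (fastforce simp: min_reps_def)
  then have "u = id" using reps_unique u(1) *(1) w by metis
  then have "w \<circ> root_refl \<gamma> = fl (w \<circ> root_refl \<gamma>)" using u(2) by (metis comp_id)
  then show ?thesis using fl_reps wW outer_refl[OF \<gamma>] weyl_group_comp by metis
qed

section \<open>The length defect of a reflection\<close>

definition pairing :: "'a \<Rightarrow> real" where
  "pairing \<delta> = (\<Sum>\<beta>\<in>outer. coroot \<delta> \<bullet> \<beta>)"

lemma pairing_rho:
  "coroot \<delta> \<bullet> (2 *\<^sub>R half_sum pos - 2 *\<^sub>R half_sum posJ) = pairing \<delta>"
proof -
  have "posJ \<subseteq> pos" by (auto simp: pos_roots_sub_def)
  then show ?thesis
    by (simp add: half_sum_def pairing_def inner_sum_right[symmetric] sum_diff finite_pos)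
qed

lemma pairing_WJ:
  assumes "u \<in> WJ"
  shows "pairing (u \<delta>) = pairing \<delta>"
proof -
  have "pairing (u \<delta>) = (\<Sum>\<beta>\<in>outer. coroot (u \<delta>) \<bullet> u \<beta>)"
    unfolding pairing_def
    by (rule sum.reindex_bij_betw[OF bij_outer_WJ[OF assms], symmetric])
  then show ?thesis
    by (simp add: pairing_def coroot_orthogonal_inner[OF weyl_group_orthogonal[OF assms]])
qed

lemma pairing_root_refl: "pairing (root_refl \<gamma> \<delta>) = pairing \<delta> - (coroot \<delta> \<bullet> \<gamma>) * pairing \<gamma>"
  by (simp add: pairing_def coroot_root_refl inner_diff_left sum_subtractf sum_distrib_left)

text \<open>Adding a nonnegative multiple of \<open>\<gamma>\<close> to \<open>\<beta>\<close> preserves its positive coefficients at simple roots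
  outside \<open>J\<close>, and a root with such a coefficient is a positive root outside \<open>\<Phi>\<^sub>J\<close>.\<close>

lemma coroot_ge_1:
  assumes "\<gamma> \<in> outer" "\<beta> \<in> outer" "root_refl \<gamma> \<beta> \<notin> outer"
  shows "coroot \<gamma> \<bullet> \<beta> \<ge> 1"
proof (rule ccontr)
  assume "\<not> ?thesis"
  moreover have "coroot \<gamma> \<bullet> \<beta> \<in> \<int>" using coroot_integral outer_root assms by blast
  ultimately have k: "coroot \<gamma> \<bullet> \<beta> \<le> 0" by (auto simp: Ints_def)
  obtain b where b: "b \<in> \<Delta> - J" "coef b \<beta> > 0" using assms(2) outer_iff by blast
  have "coef b \<gamma> \<ge> 0" using b(1) pos_coef[OF outer_pos[OF assms(1)]] by blast
  then have "coef b (root_refl \<gamma> \<beta>) > 0"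
    using b(2) k mult_nonpos_nonneg[of "coroot \<gamma> \<bullet> \<beta>" "coef b \<gamma>"]
    by (simp add: root_refl_def coef_simps)
  then show False
    using assms b(1) outer_iff root_refl_root outer_root by blast
qed

text \<open>The roots that the reflection in \<open>\<gamma>\<close> permutes contribute nothing.  Each other root
  contributes at most one to the left-hand side and at least one to the pairing, and \<open>\<gamma>\<close> itself
  contributes two to the pairing.\<close>

lemma plen_drop_le:
  assumes v: "v \<in> W" and \<gamma>: "\<gamma> \<in> outer"
  shows "plen v - plen (v \<circ> root_refl \<gamma>) \<le> pairing \<gamma> - 1"
proof -
  define A where "A = {\<beta> \<in> outer. root_refl \<gamma> \<beta> \<in> outer}"
  define f where "f \<beta> = coroot \<gamma> \<bullet> \<beta> - neg (v \<beta>) + neg (v (root_refl \<gamma> \<beta>))" for \<beta>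
  have \<gamma>0: "\<gamma> \<noteq> 0" using outer_root[OF \<gamma>] zero_not_root by blast
  have "bij_betw (root_refl \<gamma>) A A"
    by (rule bij_betw_byWitness[where f' = "root_refl \<gamma>"]) (auto simp: A_def)
  note reindex = sum.reindex_bij_betw[OF this]
  have "coroot \<gamma> \<bullet> root_refl \<gamma> \<beta> = - (coroot \<gamma> \<bullet> \<beta>)" for \<beta>
    using \<gamma>0 by (simp add: root_refl_def inner_diff_right coroot_inner_self)
  then have "(\<Sum>\<beta>\<in>A. coroot \<gamma> \<bullet> \<beta>) = - (\<Sum>\<beta>\<in>A. coroot \<gamma> \<bullet> \<beta>)"
    using reindex[of "\<lambda>\<beta>. coroot \<gamma> \<bullet> \<beta>"] by (simp add: sum_negf)
  then have "(\<Sum>\<beta>\<in>A. f \<beta>) = 0"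
    using reindex[of "\<lambda>\<beta>. neg (v \<beta>)"] by (simp add: f_def sum.distrib sum_subtractf)
  moreover have "(\<Sum>\<beta>\<in>outer - A. f \<beta>) \<ge> 1"
  proof -
    have \<gamma>A: "\<gamma> \<in> outer - A"
      using \<gamma> \<gamma>0 outer_not_minus[OF \<gamma>] by (auto simp: A_def root_refl_self)
    have ge: "f \<beta> \<ge> 0" if "\<beta> \<in> outer - A" for \<beta>
    proof -
      have "root_refl \<gamma> \<beta> \<notin> outer" using that unfolding A_def by blast
      then have "coroot \<gamma> \<bullet> \<beta> \<ge> 1" using coroot_ge_1[OF \<gamma>] that by blast
      then show ?thesis by (simp add: f_def neg_def)
    qed
    have "f \<gamma> \<ge> 1"
      using \<gamma>0 by (simp add: f_def neg_def coroot_inner_self)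
    also have "f \<gamma> \<le> (\<Sum>\<beta>\<in>outer - A. f \<beta>)"
      by (rule member_le_sum[OF \<gamma>A]) (use ge finite_outer in auto)
    finally show ?thesis .
  qed
  moreover have "(\<Sum>\<beta>\<in>outer. f \<beta>) = (\<Sum>\<beta>\<in>outer - A. f \<beta>) + (\<Sum>\<beta>\<in>A. f \<beta>)"
    by (rule sum.subset_diff) (auto simp: A_def finite_outer)
  moreover have "(\<Sum>\<beta>\<in>outer. f \<beta>) = pairing \<gamma> - plen v + plen (v \<circ> root_refl \<gamma>)"
    by (simp add: f_def pairing_def plen_def sum.distrib sum_subtractf)
  ultimately show ?thesis by linarith
qed

lemma plen_nonneg: "plen v \<ge> 0"
  by (simp add: plen_card)

lemma pairing_pos:
  assumes "\<gamma> \<in> outer"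
  shows "pairing \<gamma> > 0"
proof -
  have "plen id = 0"
    using outer_pos unfolding plen_def by (intro sum.neutral) (auto simp: neg_def)
  then show ?thesis
    using plen_drop_le[OF outer_refl[OF assms] assms] plen_nonneg[of "root_refl \<gamma>"] by simp
qed

text \<open>In terms of the affine Weyl group, the change of the semi-infinite length from \<open>v\<close> to
  \<open>v r\<^sub>\<gamma>\<close>, combined with the translation by \<open>\<gamma>\<^sup>\<or>\<close> if \<open>v \<gamma>\<close> is negative.  The edges of the graph
  are the arrows for which it takes its least possible value 1.\<close>

definition excess :: "('a \<Rightarrow> 'a) \<Rightarrow> 'a \<Rightarrow> real" where
  "excess v \<gamma> = plen (v \<circ> root_refl \<gamma>) - plen v + neg (v \<gamma>) * pairing \<gamma>"

lemma excess_ge_1: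
  assumes "v \<in> W" "\<gamma> \<in> outer"
  shows "excess v \<gamma> \<ge> 1"
proof (cases "v \<gamma> \<in> pos")
  case True
  then have "plen v < plen (v \<circ> root_refl \<gamma>)" using plen_less assms by blast
  then show ?thesis using True by (simp add: excess_def neg_def plen_card)
next
  case False
  then show ?thesis using plen_drop_le[OF assms] by (simp add: excess_def neg_def)
qed

lemma excess_WJ:
  assumes "u \<in> WJ"
  shows "excess v (u \<gamma>) = excess (v \<circ> u) \<gamma>"
proof -
  have "v \<circ> u \<circ> root_refl \<gamma> = v \<circ> root_refl (u \<gamma>) \<circ> u"
    by (simp only: comp_assoc root_refl_conjugate[OF weyl_group_orthogonal[OF assms]])
  then have "plen (v \<circ> u \<circ> root_refl \<gamma>) = plen (v \<circ> root_refl (u \<gamma>))"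
    using plen_WJ[OF assms] by metis
  then show ?thesis by (simp add: excess_def pairing_WJ[OF assms] plen_WJ[OF assms])
qed

section \<open>Edges\<close>

definition kind_of :: "'a \<Rightarrow> edge_kind" where
  "kind_of \<eta> = (if \<eta> \<in> pos then Bruhat else Quantum)"

abbreviation E :: "'a edge \<Rightarrow> bool" where "E \<equiv> qb_edge \<Phi> \<Delta> J"

text \<open>Along a Bruhat edge the length grows, and along a quantum edge it does not, as the pairing
  with \<open>2\<rho> - 2\<rho>\<^sub>J\<close> is positive; this fixes the sign of \<open>w \<gamma>\<close>.  The condition for a Bruhat edge
  concerns the length of \<open>w r\<^sub>\<gamma>\<close> and not that of its minimal representative; the two agree
  because a cover is minimal in its coset.\<close>

lemma edge_iff:
  "E (Edge w \<gamma> k t) \<longleftrightarrow>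
    w \<in> reps \<and> \<gamma> \<in> outer \<and> t = fl (w \<circ> root_refl \<gamma>) \<and> k = kind_of (w \<gamma>) \<and> excess w \<gamma> = 1"
proof (cases "w \<in> reps \<and> \<gamma> \<in> outer")
  case True
  then have w: "w \<in> reps" "w \<in> W" and \<gamma>: "\<gamma> \<in> outer" "\<gamma> \<in> pos"
    using reps_W by auto
  let ?v = "w \<circ> root_refl \<gamma>"
  have v: "?v \<in> W" by (rule weyl_group_comp[OF w(2) outer_refl[OF \<gamma>(1)]])
  have flv: "fl ?v \<in> reps" by (rule fl_reps[OF v])
  have lenw: "real (len w) = plen w" by (rule reps_len[OF w(1)])
  have lenfl: "real (len (fl ?v)) = plen ?v" using reps_len[OF flv] by (simp only: plen_fl)
  have ge: "excess w \<gamma> \<ge> 1" by (rule excess_ge_1[OF w(2) \<gamma>(1)])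
  have bruhat: "len ?v = len w + 1 \<longleftrightarrow> w \<gamma> \<in> pos \<and> excess w \<gamma> = 1"
  proof
    assume len: "len ?v = len w + 1"
    then have pos: "w \<gamma> \<in> pos" using len_refl_less[OF w(2) \<gamma>(2)] by fastforce
    moreover have "plen ?v \<le> plen w + 1" using plen_le[OF v] len lenw by simp
    ultimately show "w \<gamma> \<in> pos \<and> excess w \<gamma> = 1" using ge by (simp add: excess_def neg_def)
  next
    assume *: "w \<gamma> \<in> pos \<and> excess w \<gamma> = 1"
    then have cover: "plen ?v = plen w + 1" by (auto simp: excess_def neg_def)
    then have "?v \<in> reps" using cover_is_minimal[OF w(1) \<gamma>(1)] * by blast
    then have "real (len ?v) = plen ?v" by (rule reps_len)
    then show "len ?v = len w + 1" using cover lenw by linarith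
  qed
  have quantum: "real (len (fl ?v)) = real (len w) + 1 - pairing \<gamma> \<longleftrightarrow> w \<gamma> \<notin> pos \<and> excess w \<gamma> = 1"
    using ge pairing_pos[OF \<gamma>(1)] unfolding lenfl lenw by (auto simp: excess_def neg_def)
  show ?thesis
    unfolding qb_edge_def edge.sel pairing_rho
    using True flv bruhat quantum by (cases k) (auto simp: kind_of_def)
next
  case False
  then show ?thesis by (auto simp: qb_edge_def)
qed

text \<open>The elements \<open>r\<^sub>\<theta> w\<close> and \<open>w r\<^sub>\<gamma>\<close> need not be minimal in their cosets.  Moving the factor \<open>z\<close> past
  the reflection transfers the description of the edges to them.\<close>

lemma edge_coset:
  assumes v: "v \<in> W" and z: "z \<in> WJ" "v = fl v \<circ> z"
  shows "E (Edge (fl v) (z \<gamma>) k t) \<longleftrightarrow>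
    \<gamma> \<in> outer \<and> t = fl (v \<circ> root_refl \<gamma>) \<and> k = kind_of (v \<gamma>) \<and> excess v \<gamma> = 1"
proof -
  have "v \<circ> root_refl \<gamma> = fl v \<circ> z \<circ> root_refl \<gamma>" by (simp only: z(2)[symmetric])
  also have "\<dots> = fl v \<circ> root_refl (z \<gamma>) \<circ> z"
    by (simp only: comp_assoc root_refl_conjugate[OF weyl_group_orthogonal[OF z(1)]])
  finally have "fl (v \<circ> root_refl \<gamma>) = fl (fl v \<circ> root_refl (z \<gamma>))"
    using fl_comp[OF z(1)] by metis
  moreover have "fl v (z \<gamma>) = v \<gamma>" using fun_cong[OF z(2), of \<gamma>] by simp
  moreover have "excess (fl v) (z \<gamma>) = excess v \<gamma>" using excess_WJ[OF z(1)] z(2) by metis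
  ultimately show ?thesis
    using fl_reps[OF v] outer_WJ_iff[OF z(1)] by (auto simp only: edge_iff)
qed

section \<open>Left multiplication by affine simple reflections\<close>

text \<open>This formula for the effect of the reflection on signs is common to the simple roots \<open>\<psi>\<close>,
  where \<open>neg \<psi> = 0\<close>, and to \<open>\<psi> = - \<theta>\<close>, where \<open>neg \<psi> = 1\<close>: these are the finite parts of the
  simple affine roots.\<close>

definition affine_simple :: "'a \<Rightarrow> bool" where
  "affine_simple \<psi> \<longleftrightarrow> \<psi> \<in> \<Phi> \<and> (\<forall>\<eta>\<in>\<Phi>.
     neg (root_refl \<psi> \<eta>) = neg \<eta> + of_bool (\<eta> = \<psi>) - of_bool (\<eta> = - \<psi>) - neg \<psi> * (coroot \<psi> \<bullet> \<eta>))"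

lemma affine_simpleI:
  assumes \<psi>: "\<psi> \<in> \<Phi>" and pos: "\<And>\<eta>. \<eta> \<in> pos \<Longrightarrow>
     neg (root_refl \<psi> \<eta>) = of_bool (\<eta> = \<psi>) - of_bool (\<eta> = - \<psi>) - neg \<psi> * (coroot \<psi> \<bullet> \<eta>)"
  shows "affine_simple \<psi>"
  unfolding affine_simple_def
proof (intro conjI ballI \<psi>)
  fix \<eta> assume \<eta>: "\<eta> \<in> \<Phi>"
  show "neg (root_refl \<psi> \<eta>) =
    neg \<eta> + of_bool (\<eta> = \<psi>) - of_bool (\<eta> = - \<psi>) - neg \<psi> * (coroot \<psi> \<bullet> \<eta>)"
  proof (cases "\<eta> \<in> pos")
    case True
    then show ?thesis using pos[OF True] by (simp add: neg_def)
  next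
    case False
    then have "- \<eta> \<in> pos" using pos_or_minus_pos \<eta> by blast
    note pos[OF this]
    moreover have "root_refl \<psi> (- \<eta>) = - root_refl \<psi> \<eta>"
      by (rule linear_neg[OF root_refl_linear])
    ultimately have "1 - neg (root_refl \<psi> \<eta>) =
        of_bool (- \<eta> = \<psi>) - of_bool (\<eta> = \<psi>) + neg \<psi> * (coroot \<psi> \<bullet> \<eta>)"
      by (simp add: neg_minus root_refl_root \<psi> \<eta>)
    moreover have "- \<eta> = \<psi> \<longleftrightarrow> \<eta> = - \<psi>" by auto
    ultimately show ?thesis using False by (simp add: neg_def)
  qed
qed

lemma affine_simple_root: "affine_simple \<psi> \<Longrightarrow> \<psi> \<in> \<Phi>"
  by (simp add: affine_simple_def)

lemma simple_affine_simple:
  assumes a: "a \<in> \<Delta>"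
  shows "affine_simple a"
proof (rule affine_simpleI)
  show "a \<in> \<Phi>" using simple_root a .
  then have refl: "root_refl a a = - a" using zero_not_root root_refl_self by metis
  fix \<eta> assume \<eta>: "\<eta> \<in> pos"
  have "\<eta> \<noteq> - a" using \<eta> not_pos_minus simple_pos[OF a] by blast
  moreover have "neg (root_refl a \<eta>) = of_bool (\<eta> = a)"
    using refl not_pos_minus[OF simple_pos[OF a]] simple_refl_pos[OF a \<eta>] by (auto simp: neg_def)
  ultimately show "neg (root_refl a \<eta>) =
      of_bool (\<eta> = a) - of_bool (\<eta> = - a) - neg a * (coroot a \<bullet> \<eta>)"
    using simple_pos[OF a] by (simp add: neg_def)
qed

lemma highest_root_coef_le:
  assumes "highest_root \<Phi> \<Delta> \<theta>" "\<beta> \<in> \<Phi>" "b \<in> \<Delta>"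
  shows "coef b \<beta> \<le> coef b \<theta>"
  using assms by (fastforce simp: highest_root_def nat_span_iff coef_diff Nats_altdef2)

lemma highest_root_pos:
  assumes "highest_root \<Phi> \<Delta> \<theta>"
  shows "\<theta> \<in> pos"
proof -
  have \<theta>: "\<theta> \<in> \<Phi>" using assms by (simp add: highest_root_def)
  have "coef b \<theta> \<ge> 0" if "b \<in> \<Delta>" for b
    using highest_root_coef_le[OF assms root_minus[OF \<theta>] that] by (simp add: coef_uminus)
  then show ?thesis using \<theta> by (simp add: pos_iff)
qed

lemma highest_root_neg: "highest_root \<Phi> \<Delta> \<theta> \<Longrightarrow> neg (- \<theta>) = 1"
  using highest_root_pos not_pos_minus by (simp add: neg_def)

text \<open>Since no root exceeds \<open>\<theta>\<close>, it is dominant, and no positive root but \<open>\<theta>\<close> itself pairs with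
  its coroot to more than one.\<close>

lemma highest_root_affine_simple:
  assumes "highest_root \<Phi> \<Delta> \<theta>"
  shows "affine_simple (- \<theta>)"
proof (rule affine_simpleI)
  note le = highest_root_coef_le[OF assms] and \<theta>pos = highest_root_pos[OF assms]
  have \<theta>: "\<theta> \<in> \<Phi>" using pos_root[OF \<theta>pos] .
  show "- \<theta> \<in> \<Phi>" using root_minus \<theta> .
  have \<theta>0: "\<theta> \<noteq> 0" using \<theta> zero_not_root by blast
  have dominant: "b \<bullet> \<theta> \<ge> 0" if b: "b \<in> \<Delta>" for b
  proof -
    have "coef b (root_refl b \<theta>) \<le> coef b \<theta>"
      using le root_refl_root \<theta> simple_root b by blast
    then have "coroot b \<bullet> \<theta> \<ge> 0" using b by (simp add: root_refl_def coef_simps coef_simple)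
    moreover have "b \<noteq> 0" using simple_root[OF b] zero_not_root by blast
    then have "b \<bullet> b > 0" by simp
    ultimately show ?thesis by (simp add: coroot_def zero_le_mult_iff zero_le_divide_iff)
  qed
  fix \<eta> assume \<eta>: "\<eta> \<in> pos"
  then have \<eta>r: "\<eta> \<in> \<Phi>" by (rule pos_root)
  let ?k = "coroot \<theta> \<bullet> \<eta>"
  have "\<theta> \<bullet> \<eta> = (\<Sum>b\<in>\<Delta>. coef b \<eta> * (b \<bullet> \<theta>))"
    by (subst (1) coef_expansion[of \<eta>, symmetric]) (simp add: inner_sum_right inner_commute)
  also have "\<dots> \<ge> 0"
    by (intro sum_nonneg mult_nonneg_nonneg pos_coef[OF \<eta>] dominant)
  finally have k0: "?k \<ge> 0" by (simp add: coroot_def)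
  have kint: "?k \<in> \<int>" using coroot_integral \<theta> \<eta>r by blast
  have refl\<eta>: "root_refl \<theta> \<eta> \<in> \<Phi>" using root_refl_root \<theta> \<eta>r .
  have kle: "\<eta> = \<theta>" if k: "?k \<ge> 2"
  proof (rule coef_eqI)
    fix b assume b: "b \<in> \<Delta>"
    have "coef b (- root_refl \<theta> \<eta>) \<le> coef b \<theta>" using le root_minus refl\<eta> b by blast
    then have "(?k - 1) * coef b \<theta> \<le> coef b \<eta>"
      by (simp add: root_refl_def coef_simps algebra_simps)
    moreover have "1 * coef b \<theta> \<le> (?k - 1) * coef b \<theta>"
      using k pos_coef[OF \<theta>pos b] by (intro mult_right_mono) auto
    ultimately show "coef b \<eta> = coef b \<theta>" using le[OF \<eta>r b] by simp
  qed
  have "neg (root_refl \<theta> \<eta>) = ?k - of_bool (\<eta> = \<theta>)"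
  proof -
    obtain m where m: "?k = of_int m" using kint by (auto elim: Ints_cases)
    consider "m = 0" | "m = 1" | "m \<ge> 2" using k0 m by fastforce
    then show ?thesis
    proof cases
      case 1
      then have "\<eta> \<noteq> \<theta>" using m \<theta>0 coroot_inner_self by force
      then show ?thesis using 1 m \<eta> by (simp add: root_refl_def neg_def)
    next
      case 2
      then have "root_refl \<theta> \<eta> = \<eta> - \<theta>" using m by (simp add: root_refl_def)
      then have "\<forall>b\<in>\<Delta>. coef b (- root_refl \<theta> \<eta>) \<ge> 0" using le \<eta>r by (simp add: coef_simps)
      then have "- root_refl \<theta> \<eta> \<in> pos" using root_minus[OF refl\<eta>] by (simp add: pos_iff)
      then have "root_refl \<theta> \<eta> \<notin> pos" using not_pos_minus by fastforce
      moreover have "\<eta> \<noteq> \<theta>" using 2 m \<theta>0 coroot_inner_self by force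
      ultimately show ?thesis using 2 m by (simp add: neg_def)
    next
      case 3
      then have "\<eta> = \<theta>" using kle m by simp
      then show ?thesis using \<theta>0 not_pos_minus[OF \<theta>pos]
        by (simp add: root_refl_self neg_def coroot_inner_self)
    qed
  qed
  moreover have "\<eta> \<noteq> - \<theta>" using \<eta> not_pos_minus \<theta>pos by blast
  ultimately show "neg (root_refl (- \<theta>) \<eta>) =
      of_bool (\<eta> = - \<theta>) - of_bool (\<eta> = - (- \<theta>)) - neg (- \<theta>) * (coroot (- \<theta>) \<bullet> \<eta>)"
    using not_pos_minus[OF \<theta>pos] by (simp add: neg_def)
qed

definition side :: "'a \<Rightarrow> real" where
  "side \<delta> = of_bool (\<delta> \<in> outer) - of_bool (- \<delta> \<in> outer)"

lemma plen_affine_simple: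
  assumes v: "v \<in> W" and \<psi>: "affine_simple \<psi>"
  shows "plen (root_refl \<psi> \<circ> v) = plen v + side (inv v \<psi>) - neg \<psi> * pairing (inv v \<psi>)"
proof -
  let ?\<delta> = "inv v \<psi>"
  have v\<delta>: "v ?\<delta> = \<psi>" using weyl_inv_apply(1)[OF v] .
  have eq1: "v \<beta> = \<psi> \<longleftrightarrow> \<beta> = ?\<delta>" for \<beta> using v\<delta> weyl_inv_apply(2)[OF v] by metis
  have eq2: "v \<beta> = - \<psi> \<longleftrightarrow> \<beta> = - ?\<delta>" for \<beta>
    using v\<delta> weyl_inv_apply(2)[OF v] weyl_group_minus[OF v] by metis
  have coroot: "coroot \<psi> \<bullet> v \<beta> = coroot ?\<delta> \<bullet> \<beta>" for \<beta>
    using coroot_orthogonal_inner[OF weyl_group_orthogonal[OF v], of ?\<delta> \<beta>] v\<delta> by simp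
  have delta: "(\<Sum>\<beta>\<in>outer. of_bool (\<beta> = x)) = (of_bool (x \<in> outer) :: real)" for x
    unfolding of_bool_def by (subst sum.delta'[OF finite_outer, symmetric]) (auto intro: sum.cong)
  have "plen (root_refl \<psi> \<circ> v) = (\<Sum>\<beta>\<in>outer. neg (v \<beta>) + of_bool (\<beta> = ?\<delta>) - of_bool (\<beta> = - ?\<delta>)
      - neg \<psi> * (coroot ?\<delta> \<bullet> \<beta>))"
    unfolding plen_def
  proof (rule sum.cong)
    fix \<beta> assume "\<beta> \<in> outer"
    then have "v \<beta> \<in> \<Phi>" using W_root[OF v] outer_root by blast
    then have "neg (root_refl \<psi> (v \<beta>)) = neg (v \<beta>) + of_bool (v \<beta> = \<psi>) - of_bool (v \<beta> = - \<psi>)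
        - neg \<psi> * (coroot \<psi> \<bullet> v \<beta>)" using \<psi> unfolding affine_simple_def by blast
    then show "neg ((root_refl \<psi> \<circ> v) \<beta>) = neg (v \<beta>) + of_bool (\<beta> = ?\<delta>) - of_bool (\<beta> = - ?\<delta>)
      - neg \<psi> * (coroot ?\<delta> \<bullet> \<beta>)" by (simp only: comp_apply eq1 eq2 coroot)
  qed simp
  also have "\<dots> = plen v + side ?\<delta> - neg \<psi> * pairing ?\<delta>"
    by (simp only: sum.distrib sum_subtractf delta plen_def pairing_def side_def sum_distrib_left)
  finally show ?thesis .
qed

lemma excess_affine_simple:
  assumes v: "v \<in> W" and \<psi>: "affine_simple \<psi>" and \<delta>: "inv v \<psi> \<in> outer"
  shows "excess v (inv v \<psi>) = 1"
proof -
  have "side (inv v \<psi>) = 1" using \<delta> outer_not_minus[OF \<delta>] by (simp add: side_def)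
  then show ?thesis
    by (simp add: excess_def weyl_refl_conjugate[OF v] plen_affine_simple[OF v \<psi>]
      weyl_inv_apply(1)[OF v])
qed

lemma inv_weyl_refl:
  assumes "v \<in> W" "\<gamma> \<in> \<Phi>"
  shows "inv (v \<circ> root_refl \<gamma>) x = root_refl \<gamma> (inv v x)"
proof -
  have "v \<circ> root_refl \<gamma> \<in> W" using assms refl_in_W weyl_group_comp by blast
  from weyl_inv_apply(2)[OF this, of "root_refl \<gamma> (inv v x)"] show ?thesis
    by (simp add: weyl_inv_apply(1)[OF assms(1)])
qed

lemma neg_affine_simple:
  assumes v: "v \<in> W" and \<psi>: "affine_simple \<psi>" and \<gamma>: "\<gamma> \<in> \<Phi>"
    and ne: "\<gamma> \<noteq> inv v \<psi>" "\<gamma> \<noteq> - inv v \<psi>"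
  shows "neg (root_refl \<psi> (v \<gamma>)) = neg (v \<gamma>) - neg \<psi> * (coroot (inv v \<psi>) \<bullet> \<gamma>)"
proof -
  let ?\<delta> = "inv v \<psi>"
  have v\<delta>: "v ?\<delta> = \<psi>" using weyl_inv_apply(1)[OF v] .
  have "v \<gamma> \<noteq> \<psi>" using ne(1) weyl_inv_apply(2)[OF v] by metis
  moreover have "v \<gamma> \<noteq> - \<psi>"
    using ne(2) weyl_inv_apply(2)[OF v] weyl_group_minus[OF v] v\<delta> by metis
  moreover have "coroot \<psi> \<bullet> v \<gamma> = coroot ?\<delta> \<bullet> \<gamma>"
    using coroot_orthogonal_inner[OF weyl_group_orthogonal[OF v], of ?\<delta> \<gamma>] v\<delta> by simp
  ultimately show ?thesis using \<psi> W_root[OF v \<gamma>] by (simp add: affine_simple_def)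
qed

text \<open>The pairings that the two translations and the change of sign of \<open>v \<gamma>\<close> contribute cancel.\<close>

lemma excess_reflected:
  assumes v: "v \<in> W" and \<psi>: "affine_simple \<psi>" and \<gamma>: "\<gamma> \<in> outer"
    and ne: "\<gamma> \<noteq> inv v \<psi>" "\<gamma> \<noteq> - inv v \<psi>"
  shows "excess (root_refl \<psi> \<circ> v) \<gamma> =
    excess v \<gamma> + side (root_refl \<gamma> (inv v \<psi>)) - side (inv v \<psi>)"
proof -
  have v': "v \<circ> root_refl \<gamma> \<in> W" by (rule weyl_group_comp[OF v outer_refl[OF \<gamma>]])
  have "plen (root_refl \<psi> \<circ> v \<circ> root_refl \<gamma>) = plen (v \<circ> root_refl \<gamma>)
      + side (root_refl \<gamma> (inv v \<psi>)) - neg \<psi> * pairing (root_refl \<gamma> (inv v \<psi>))"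
    using plen_affine_simple[OF v' \<psi>] by (simp only: comp_assoc inv_weyl_refl[OF v outer_root[OF \<gamma>]])
  then show ?thesis
    unfolding excess_def plen_affine_simple[OF v \<psi>] comp_apply
      neg_affine_simple[OF v \<psi> outer_root[OF \<gamma>] ne] pairing_root_refl
    by (simp add: algebra_simps)
qed

section \<open>Weights\<close>

abbreviation QJ :: "'a set" where "QJ \<equiv> coroot_lattice J"

lemma QJ_neg_scale: "x \<in> QJ \<Longrightarrow> neg \<eta> *\<^sub>R x \<in> QJ"
  by (simp add: coroot_lattice_def neg_def int_span_0)

text \<open>A simple reflection in \<open>J\<close> changes a coroot by an integral multiple of a simple coroot.\<close>

lemma coroot_WJ:
  assumes "u \<in> WJ" "\<beta> \<in> \<Phi>"
  shows "coroot (u \<beta>) - coroot \<beta> \<in> QJ"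
  using assms(1)
proof (induction rule: weyl_group_induct)
  case id
  then show ?case by (simp add: coroot_lattice_def int_span_0)
next
  case (refl a u)
  have a: "a \<in> \<Phi>" using refl(1) J_subset simple_root by blast
  have "u \<beta> \<in> \<Phi>" using W_root[OF WJ_W[OF refl(2)]] assms(2) by blast
  then obtain k where k: "coroot (u \<beta>) \<bullet> a = of_int k"
    using coroot_integral a by (meson Ints_cases)
  have "coroot a \<in> int_span (coroot ` J)"
    using refl(1) finite_subset[OF J_subset finite_simple] by (intro int_span_base) auto
  from int_span_scale[OF this] have "(coroot (u \<beta>) - coroot \<beta>) - of_int k *\<^sub>R coroot a \<in> QJ"
    using refl(3) unfolding coroot_lattice_def by (rule int_span_diff[rotated])
  then show ?case by (simp add: coroot_root_refl k algebra_simps)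
qed

lemma edge_weight_kind: "edge_weight (Edge s l (kind_of \<eta>) t) = neg \<eta> *\<^sub>R coroot l"
  by (simp add: edge_weight_def kind_of_def neg_def)

lemma diamondI:
  assumes "E (Edge x l1 k1 y1)" "E (Edge y1 l2 k2 t)" "E (Edge x l3 k3 y2)" "E (Edge y2 l4 k4 t)"
    and "edge_weight (Edge x l1 k1 y1) + edge_weight (Edge y1 l2 k2 t) -
      (edge_weight (Edge x l3 k3 y2) + edge_weight (Edge y2 l4 k4 t)) \<in> QJ"
  shows "diamond \<Phi> \<Delta> J [Edge x l1 k1 y1, Edge y1 l2 k2 t] [Edge x l3 k3 y2, Edge y2 l4 k4 t]"
proof -
  have "t \<in> reps" using assms(2) unfolding qb_edge_def edge.sel by blast
  then show ?thesis using assms by (auto simp: diamond_def path_weight_def)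
qed

section \<open>Diamonds\<close>

lemma label_transport:
  assumes v: "v \<in> W" and u: "u \<in> WJ" "v = fl v \<circ> u"
  shows "inv (fl v) x = u (inv v x)"
proof -
  have "fl v (u (inv v x)) = x" using fun_cong[OF u(2), of "inv v x"] weyl_inv_apply(1)[OF v] by simp
  then show ?thesis using weyl_inv_apply(2)[OF reps_W[OF fl_reps[OF v]]] by metis
qed

text \<open>The next two lemmas compare the excess of \<open>\<gamma>\<close> at \<open>w\<close> and at \<open>r\<^sub>\<psi> w\<close>.  The difference is governed
  by the sides of \<open>w\<^sup>-\<^sup>1 \<psi>\<close> and of its image under the reflection in \<open>\<gamma>\<close>; given one of the two sides,
  the bound on the excess leaves a single possibility for the other.\<close>

lemma diamond_up:
  assumes \<psi>: "affine_simple \<psi>" and z: "z \<in> WJ" "root_refl \<psi> \<circ> w = fl (root_refl \<psi> \<circ> w) \<circ> z"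
    and ne: "\<gamma> \<noteq> inv w \<psi>"
  defines "y \<equiv> fl (w \<circ> root_refl \<gamma>)" and "y' \<equiv> fl (root_refl \<psi> \<circ> w \<circ> root_refl \<gamma>)"
  defines "b1 \<equiv> Edge w (inv w \<psi>) (kind_of \<psi>) (fl (root_refl \<psi> \<circ> w))"
    and "b2 \<equiv> Edge w \<gamma> (kind_of (w \<gamma>)) y"
    and "t1 \<equiv> Edge (fl (root_refl \<psi> \<circ> w)) (z \<gamma>) (kind_of (root_refl \<psi> (w \<gamma>))) y'"
    and "t2 \<equiv> Edge y (inv y \<psi>) (kind_of \<psi>) y'"
  assumes b1: "E b1" and b2: "E b2"
  shows "E t1" "E t2" "diamond \<Phi> \<Delta> J [b1, t1] [b2, t2]"
proof -
  let ?\<delta> = "inv w \<psi>" and ?v = "w \<circ> root_refl \<gamma>" and ?x = "root_refl \<psi> \<circ> w"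
  have w: "w \<in> reps" "w \<in> W" and \<delta>: "?\<delta> \<in> outer" and \<gamma>: "\<gamma> \<in> outer" and ex: "excess w \<gamma> = 1"
    using b1 b2 reps_W by (auto simp: b1_def b2_def edge_iff)
  have \<psi>W: "root_refl \<psi> \<in> W" by (rule refl_in_W[OF affine_simple_root[OF \<psi>]])
  have x: "?x \<in> W" by (rule weyl_group_comp[OF \<psi>W w(2)])
  have v: "?v \<in> W" by (rule weyl_group_comp[OF w(2) outer_refl[OF \<gamma>]])
  have ne': "\<gamma> \<noteq> - ?\<delta>" using \<gamma> outer_not_minus[OF \<delta>] by blast
  have side1: "side ?\<delta> = 1" using \<delta> outer_not_minus[OF \<delta>] by (simp add: side_def)
  have "excess ?x \<gamma> \<ge> 1" by (rule excess_ge_1[OF x \<gamma>])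
  then have "side (root_refl \<gamma> ?\<delta>) \<ge> 1"
    using excess_reflected[OF w(2) \<psi> \<gamma> ne ne'] ex side1 by simp
  then have \<delta>': "root_refl \<gamma> ?\<delta> \<in> outer" and "side (root_refl \<gamma> ?\<delta>) = 1"
    by (auto simp: side_def of_bool_def split: if_splits)
  then have ex1: "excess ?x \<gamma> = 1"
    using excess_reflected[OF w(2) \<psi> \<gamma> ne ne'] ex side1 by simp
  obtain u where u: "u \<in> WJ" "?v = fl ?v \<circ> u" using fl_factor .
  have inv_v: "inv ?v \<psi> = root_refl \<gamma> ?\<delta>" by (rule inv_weyl_refl[OF w(2) outer_root[OF \<gamma>]])
  have label: "inv y \<psi> = u (root_refl \<gamma> ?\<delta>)"
    unfolding y_def label_transport[OF v u] inv_v ..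
  have ex2: "excess ?v (root_refl \<gamma> ?\<delta>) = 1"
    using excess_affine_simple[OF v \<psi>] \<delta>' inv_v by simp
  have target: "?v \<circ> root_refl (root_refl \<gamma> ?\<delta>) = ?x \<circ> root_refl \<gamma>"
    using weyl_refl_conjugate[OF v, of \<psi>] by (simp only: inv_v comp_assoc)
  have sign: "?v (root_refl \<gamma> ?\<delta>) = \<psi>"
    using weyl_inv_apply(1)[OF v, of \<psi>] by (simp only: inv_v)
  show t1: "E t1" unfolding t1_def y'_def edge_coset[OF x z] using \<gamma> ex1 by simp
  show t2: "E t2" unfolding t2_def label unfolding y_def y'_def edge_coset[OF v u]
    using \<delta>' ex2 target sign by simp
  have "edge_weight b1 + edge_weight t1 - (edge_weight b2 + edge_weight t2) =
      neg \<psi> *\<^sub>R coroot ?\<delta> + neg (root_refl \<psi> (w \<gamma>)) *\<^sub>R coroot (z \<gamma>) -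
      (neg (w \<gamma>) *\<^sub>R coroot \<gamma> + neg \<psi> *\<^sub>R coroot (u (root_refl \<gamma> ?\<delta>)))"
    by (simp only: b1_def b2_def t1_def t2_def edge_weight_kind label)
  also have "\<dots> = neg (root_refl \<psi> (w \<gamma>)) *\<^sub>R (coroot (z \<gamma>) - coroot \<gamma>) -
      neg \<psi> *\<^sub>R (coroot (u (root_refl \<gamma> ?\<delta>)) - coroot (root_refl \<gamma> ?\<delta>))"
    by (simp add: neg_affine_simple[OF w(2) \<psi> outer_root[OF \<gamma>] ne ne'] coroot_root_refl algebra_simps)
  also have "\<dots> \<in> QJ"
    using QJ_neg_scale[OF coroot_WJ[OF z(1) outer_root[OF \<gamma>]]]
      QJ_neg_scale[OF coroot_WJ[OF u(1) outer_root[OF \<delta>']]]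
    unfolding coroot_lattice_def by (rule int_span_diff)
  finally show "diamond \<Phi> \<Delta> J [b1, t1] [b2, t2]"
    using b1 b2 t1 t2 unfolding b1_def b2_def t1_def t2_def by (intro diamondI)
qed

lemma diamond_down:
  assumes \<psi>: "affine_simple \<psi>" and z: "z \<in> WJ" "root_refl \<psi> \<circ> w = fl (root_refl \<psi> \<circ> w) \<circ> z"
    and ne: "\<gamma> \<noteq> inv w \<psi>"
  defines "y \<equiv> fl (w \<circ> root_refl \<gamma>)" and "y' \<equiv> fl (root_refl \<psi> \<circ> w \<circ> root_refl \<gamma>)"
  assumes z': "z' \<in> WJ" "root_refl \<psi> \<circ> y = y' \<circ> z'"
  defines "b1 \<equiv> Edge (fl (root_refl \<psi> \<circ> w)) (- z (inv w \<psi>)) (kind_of \<psi>) w"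
    and "b2 \<equiv> Edge (fl (root_refl \<psi> \<circ> w)) (z \<gamma>) (kind_of (root_refl \<psi> (w \<gamma>))) y'"
    and "t1 \<equiv> Edge w \<gamma> (kind_of (w \<gamma>)) y"
    and "t2 \<equiv> Edge y' (- z' (inv y \<psi>)) (kind_of \<psi>) y"
  assumes t1: "E t1" and t2: "E t2"
  shows "\<gamma> \<noteq> - inv w \<psi>" "- inv w \<psi> \<in> outer" "E b1" "E b2" "diamond \<Phi> \<Delta> J [b1, t1] [b2, t2]"
proof -
  let ?\<delta> = "inv w \<psi>" and ?v = "w \<circ> root_refl \<gamma>" and ?x = "root_refl \<psi> \<circ> w"
  have w: "w \<in> reps" "w \<in> W" and \<gamma>: "\<gamma> \<in> outer" and ex: "excess w \<gamma> = 1"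
    using t1 reps_W by (auto simp: t1_def edge_iff)
  have \<psi>\<Phi>: "\<psi> \<in> \<Phi>" by (rule affine_simple_root[OF \<psi>])
  have \<gamma>\<Phi>: "\<gamma> \<in> \<Phi>" "\<gamma> \<noteq> 0" using outer_root[OF \<gamma>] zero_not_root by blast+
  have x: "?x \<in> W" by (rule weyl_group_comp[OF refl_in_W[OF \<psi>\<Phi>] w(2)])
  have v: "?v \<in> W" by (rule weyl_group_comp[OF w(2) outer_refl[OF \<gamma>]])
  obtain u where u: "u \<in> WJ" "?v = fl ?v \<circ> u" using fl_factor .
  have inv_v: "inv ?v \<psi> = root_refl \<gamma> ?\<delta>" by (rule inv_weyl_refl[OF w(2) \<gamma>\<Phi>(1)])
  have label: "- z' (inv y \<psi>) = (z' \<circ> u) (- root_refl \<gamma> ?\<delta>)"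
    unfolding y_def label_transport[OF v u] inv_v
    by (simp add: weyl_group_minus[OF u(1)] weyl_group_minus[OF z'(1)])
  have zu: "z' \<circ> u \<in> WJ" by (rule weyl_group_comp[OF z'(1) u(1)])
  have "- z' (inv y \<psi>) \<in> outer" using t2 unfolding t2_def edge_iff by blast
  then have \<delta>': "- root_refl \<gamma> ?\<delta> \<in> outer" unfolding label outer_WJ_iff[OF zu] .
  have ne': "\<gamma> \<noteq> - ?\<delta>"
  proof
    assume "\<gamma> = - ?\<delta>"
    then have "?\<delta> = - \<gamma>" by simp
    then have "- root_refl \<gamma> ?\<delta> = - \<gamma>"
      using root_refl_self[OF \<gamma>\<Phi>(2)] linear_neg[OF root_refl_linear[of \<gamma>]] by simp
    then show False using \<delta>' outer_not_minus[OF \<gamma>] by simp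
  qed
  have side1: "side (root_refl \<gamma> ?\<delta>) = - 1"
    using \<delta>' outer_not_minus[OF \<delta>'] by (simp add: side_def)
  have "excess ?x \<gamma> \<ge> 1" by (rule excess_ge_1[OF x \<gamma>])
  then have "side ?\<delta> \<le> - 1"
    using excess_reflected[OF w(2) \<psi> \<gamma> ne ne'] ex side1 by simp
  then have \<delta>: "- ?\<delta> \<in> outer" and "side ?\<delta> = - 1"
    by (auto simp: side_def of_bool_def split: if_splits)
  then have ex1: "excess ?x \<gamma> = 1"
    using excess_reflected[OF w(2) \<psi> \<gamma> ne ne'] ex side1 by simp
  have \<psi>0: "\<psi> \<noteq> 0" using \<psi>\<Phi> zero_not_root by blast
  have w\<delta>: "w ?\<delta> = \<psi>" by (rule weyl_inv_apply(1)[OF w(2)])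
  have sign: "?x (- ?\<delta>) = \<psi>"
    using root_refl_self[OF \<psi>0] w\<delta> weyl_group_minus[OF x, of ?\<delta>] by simp
  have inv_x: "inv ?x \<psi> = - ?\<delta>" using weyl_inv_apply(2)[OF x] sign by metis
  have ex2: "excess ?x (- ?\<delta>) = 1"
    using excess_affine_simple[OF x \<psi>] \<delta> inv_x by simp
  have "?x \<circ> root_refl (- ?\<delta>) = root_refl \<psi> \<circ> (root_refl \<psi> \<circ> w)"
    by (simp only: root_refl_uminus_root comp_assoc weyl_refl_conjugate[OF w(2)])
  then have target: "fl (?x \<circ> root_refl (- ?\<delta>)) = w"
    using fl_id[OF w(1)] by (simp only: root_refl_comp_cancel)
  have labelb: "- z ?\<delta> = z (- ?\<delta>)" by (simp add: weyl_group_minus[OF z(1)])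
  show "\<gamma> \<noteq> - ?\<delta>" "- ?\<delta> \<in> outer" by (rule ne', rule \<delta>)
  show b1: "E b1" unfolding b1_def labelb edge_coset[OF x z] using \<delta> ex2 target sign by simp
  show b2: "E b2" unfolding b2_def y'_def edge_coset[OF x z] using \<gamma> ex1 by simp
  have "edge_weight b1 + edge_weight t1 - (edge_weight b2 + edge_weight t2) =
      neg \<psi> *\<^sub>R coroot (z (- ?\<delta>)) + neg (w \<gamma>) *\<^sub>R coroot \<gamma> -
      (neg (root_refl \<psi> (w \<gamma>)) *\<^sub>R coroot (z \<gamma>) +
       neg \<psi> *\<^sub>R coroot ((z' \<circ> u) (- root_refl \<gamma> ?\<delta>)))"
    by (simp only: b1_def b2_def t1_def t2_def edge_weight_kind label labelb)
  also have "\<dots> = neg \<psi> *\<^sub>R (coroot (z (- ?\<delta>)) - coroot (- ?\<delta>)) -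
      neg (root_refl \<psi> (w \<gamma>)) *\<^sub>R (coroot (z \<gamma>) - coroot \<gamma>) -
      neg \<psi> *\<^sub>R (coroot ((z' \<circ> u) (- root_refl \<gamma> ?\<delta>)) - coroot (- root_refl \<gamma> ?\<delta>))"
    by (simp add: neg_affine_simple[OF w(2) \<psi> \<gamma>\<Phi>(1) ne ne'] coroot_root_refl algebra_simps)
  also have "\<dots> \<in> QJ"
    using QJ_neg_scale[OF coroot_WJ[OF z(1) outer_root[OF \<delta>]]]
      QJ_neg_scale[OF coroot_WJ[OF z(1) \<gamma>\<Phi>(1)]] QJ_neg_scale[OF coroot_WJ[OF zu outer_root[OF \<delta>']]]
    unfolding coroot_lattice_def by (rule int_span_diff[OF int_span_diff])
  finally show "diamond \<Phi> \<Delta> J [b1, t1] [b2, t2]"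
    using b1 b2 t1 t2 unfolding b1_def b2_def t1_def t2_def by (intro diamondI)
qed

text \<open>The reflection in \<open>a\<close> makes no positive root but \<open>a\<close> negative, and \<open>w\<close> maps no positive root
  of \<open>\<Phi>\<^sub>J\<close> to \<open>a\<close>.\<close>

lemma simple_refl_reps:
  assumes w: "w \<in> reps" and a: "a \<in> \<Delta>" and \<delta>: "- inv w a \<in> outer"
  shows "root_refl a \<circ> w \<in> reps"
  unfolding reps_iff
proof (intro conjI ballI)
  show "root_refl a \<circ> w \<in> W" using weyl_group_comp refl_in_W[OF simple_root[OF a]] reps_W[OF w] .
  fix \<beta> assume \<beta>: "\<beta> \<in> posJ"
  have "w \<beta> \<noteq> a"
  proof
    assume "w \<beta> = a"
    then have "inv w a = \<beta>" using weyl_inv_apply(2)[OF reps_W[OF w]] by metis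
    then show False using \<delta> \<beta> not_pos_minus posJ_iff by blast
  qed
  moreover have "w \<beta> \<in> pos" using w \<beta> reps_iff by blast
  ultimately show "(root_refl a \<circ> w) \<beta> \<in> pos" using simple_refl_pos[OF a] by simp
qed

section \<open>Diamonds for simple roots and for the highest root\<close>

lemma bruhat_target:
  assumes "E (Edge w \<gamma> Bruhat t)"
  shows "t = w \<circ> root_refl \<gamma>"
proof -
  have *: "w \<in> reps" "\<gamma> \<in> outer" "t = fl (w \<circ> root_refl \<gamma>)" "w \<gamma> \<in> pos" "excess w \<gamma> = 1"
    using assms by (auto simp: edge_iff kind_of_def split: if_splits)
  then have "plen (w \<circ> root_refl \<gamma>) = plen w + 1" by (simp add: excess_def neg_def)
  then have "w \<circ> root_refl \<gamma> \<in> reps" using cover_is_minimal * by blast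
  then show ?thesis using fl_id *(3) by metis
qed

text \<open>The edge labelled \<open>w\<^sup>-\<^sup>1 \<psi>\<close> has its kind given by the sign of \<open>\<psi>\<close>.  So an edge of the opposite
  kind has another label, which makes this hypothesis of the diamonds automatic for it.\<close>

lemma label_neq_if_kind_neq:
  assumes "E (Edge w \<gamma> k t)" "k \<noteq> kind_of \<psi>"
  shows "\<gamma> \<noteq> inv w \<psi>"
proof
  assume "\<gamma> = inv w \<psi>"
  moreover have "w \<in> W" "k = kind_of (w \<gamma>)" using assms(1) reps_W by (auto simp: edge_iff)
  ultimately show False using assms(2) weyl_inv_apply(1)[of w \<Delta> \<psi>] by simp
qed

lemma kind_of_eq_iff: "kind_of x = kind_of y \<longleftrightarrow> neg x = neg y"
  by (simp add: kind_of_def neg_def)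

lemma kind_reflected:
  assumes "w \<in> W" "affine_simple \<psi>" "\<gamma> \<in> \<Phi>" "\<gamma> \<noteq> inv w \<psi>" "\<gamma> \<noteq> - inv w \<psi>"
  shows "kind_of (root_refl \<psi> (w \<gamma>)) = kind_of (w \<gamma>) \<longleftrightarrow> neg \<psi> = 0 \<or> coroot \<gamma> \<bullet> inv w \<psi> = 0"
proof -
  have "inv w \<psi> \<noteq> 0" "\<gamma> \<noteq> 0"
    using W_root[OF weyl_group_inv[OF assms(1)]] affine_simple_root[OF assms(2)] assms(3) zero_not_root
    by force+
  then show ?thesis
    unfolding kind_of_eq_iff neg_affine_simple[OF assms] by (auto simp: coroot_def inner_commute)
qed

lemma simple_diamond_up:
  assumes a: "a \<in> \<Delta>" and ne: "\<gamma> \<noteq> inv w a"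
  defines "y \<equiv> fl (w \<circ> root_refl \<gamma>)"
  assumes b1: "E (Edge w (inv w a) Bruhat (root_refl a \<circ> w))" and b2: "E (Edge w \<gamma> k y)"
  shows "root_refl a \<circ> y = fl (root_refl a \<circ> w \<circ> root_refl \<gamma>) \<and>
    E (Edge (root_refl a \<circ> w) \<gamma> k (root_refl a \<circ> y)) \<and>
    E (Edge y (inv y a) Bruhat (root_refl a \<circ> y)) \<and>
    diamond \<Phi> \<Delta> J
      [Edge w (inv w a) Bruhat (root_refl a \<circ> w), Edge (root_refl a \<circ> w) \<gamma> k (root_refl a \<circ> y)]
      [Edge w \<gamma> k y, Edge y (inv y a) Bruhat (root_refl a \<circ> y)]"
proof -
  have kind_a: "kind_of a = Bruhat" using simple_pos[OF a] by (simp add: kind_of_def)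
  have x: "root_refl a \<circ> w \<in> reps" using b1 unfolding qb_edge_def edge.sel by blast
  have flx: "fl (root_refl a \<circ> w) = root_refl a \<circ> w" by (rule fl_id[OF x])
  have z: "id \<in> WJ" "root_refl a \<circ> w = fl (root_refl a \<circ> w) \<circ> id" using flx by simp_all
  have w: "w \<in> W" and \<delta>: "inv w a \<in> outer" and \<gamma>: "\<gamma> \<in> outer" and k: "k = kind_of (w \<gamma>)"
    using b1 b2 reps_W by (auto simp: edge_iff)
  have "\<gamma> \<noteq> - inv w a" using \<gamma> outer_not_minus[OF \<delta>] by blast
  then have k': "kind_of (root_refl a (w \<gamma>)) = k"
    using kind_reflected[OF w simple_affine_simple[OF a] outer_root[OF \<gamma>] ne] simple_pos[OF a] k
    by (simp add: neg_def)
  note up = diamond_up[OF simple_affine_simple[OF a] z ne, unfolded kind_a flx k' id_apply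
      k[symmetric] y_def[symmetric], OF b1 b2]
  have "y \<in> W" using up(2) reps_W unfolding edge_iff by blast
  then have "fl (root_refl a \<circ> w \<circ> root_refl \<gamma>) = root_refl a \<circ> y"
    using bruhat_target[OF up(2)] weyl_refl_conjugate by metis
  then show ?thesis using up by simp
qed

lemma simple_diamond_down:
  assumes a: "a \<in> \<Delta>" and ne: "\<gamma> \<noteq> inv w a"
  defines "y \<equiv> fl (w \<circ> root_refl \<gamma>)"
  assumes t1: "E (Edge w \<gamma> k y)" and t2: "E (Edge (root_refl a \<circ> y) (- inv y a) Bruhat y)"
  shows "root_refl a \<circ> y = fl (root_refl a \<circ> w \<circ> root_refl \<gamma>) \<and>
    E (Edge (root_refl a \<circ> w) (- inv w a) Bruhat w) \<and>
    E (Edge (root_refl a \<circ> w) \<gamma> k (root_refl a \<circ> y)) \<and>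
    diamond \<Phi> \<Delta> J
      [Edge (root_refl a \<circ> w) (- inv w a) Bruhat w, Edge w \<gamma> k y]
      [Edge (root_refl a \<circ> w) \<gamma> k (root_refl a \<circ> y), Edge (root_refl a \<circ> y) (- inv y a) Bruhat y]"
proof -
  note \<psi> = simple_affine_simple[OF a]
  have kind_a: "kind_of a = Bruhat" using simple_pos[OF a] by (simp add: kind_of_def)
  have w: "w \<in> reps" and \<gamma>: "\<gamma> \<in> outer" and k: "k = kind_of (w \<gamma>)"
    using t1 by (auto simp: edge_iff)
  have ry: "root_refl a \<circ> y \<in> reps" using t2 unfolding qb_edge_def edge.sel by blast
  obtain u where u: "u \<in> WJ" "w \<circ> root_refl \<gamma> = y \<circ> u" unfolding y_def using fl_factor .
  have y': "fl (root_refl a \<circ> w \<circ> root_refl \<gamma>) = root_refl a \<circ> y"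
    by (rule fl_eq[OF ry u(1)]) (simp only: comp_assoc u(2))
  have z': "root_refl a \<circ> y = root_refl a \<circ> y \<circ> (\<lambda>x. x)" by (rule ext) simp
  obtain z where z: "z \<in> WJ" "root_refl a \<circ> w = fl (root_refl a \<circ> w) \<circ> z" using fl_factor .
  \<comment> \<open>Minimality of \<open>r\<^sub>a w\<close> is itself a consequence of the diamond for the coset of \<open>r\<^sub>a w\<close>, so \<open>z\<close> is
    kept arbitrary at first and is specialised to the identity only afterwards.\<close>
  note down = diamond_down[OF \<psi> _ _ ne weyl_group_id, unfolded y_def[symmetric] y' id_apply kind_a
      k[symmetric], OF _ _ z' t1 t2]
  have "root_refl a \<circ> w \<in> reps" using simple_refl_reps[OF w a] down(2)[OF z] .
  then have flx: "fl (root_refl a \<circ> w) = root_refl a \<circ> w" by (rule fl_id)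
  have "kind_of (root_refl a (w \<gamma>)) = k"
    using kind_reflected[OF reps_W[OF w] \<psi> outer_root[OF \<gamma>] ne down(1)[OF z]] simple_pos[OF a] k
    by (simp add: neg_def)
  then show ?thesis using down(3-5)[OF weyl_group_id] y' by (simp add: flx)
qed

text \<open>Reflection in \<open>\<theta>\<close> changes the sign of exactly those roots that are not orthogonal to \<open>\<theta>\<close>, so
  orthogonality of \<open>\<gamma>\<close> and \<open>w\<^sup>-\<^sup>1 \<theta>\<close> decides whether opposite edges of the diamond have the same
  kind.  As there are only two kinds, the hypothesis on \<open>k'\<close> determines it.\<close>

lemma highest_root_kind:
  assumes \<theta>: "highest_root \<Phi> \<Delta> \<theta>" and w: "w \<in> W" and \<gamma>: "\<gamma> \<in> \<Phi>"
    and ne: "\<gamma> \<noteq> inv w (- \<theta>)" "\<gamma> \<noteq> - inv w (- \<theta>)"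
    and k': "k' = kind_of (w \<gamma>) \<longleftrightarrow> coroot \<gamma> \<bullet> inv w \<theta> = 0"
  shows "kind_of (root_refl \<theta> (w \<gamma>)) = k'"
proof -
  have "neg (- \<theta>) = 1"
    using highest_root_neg[OF \<theta>] .
  then have "kind_of (root_refl \<theta> (w \<gamma>)) = kind_of (w \<gamma>) \<longleftrightarrow> k' = kind_of (w \<gamma>)"
    using kind_reflected[OF w highest_root_affine_simple[OF \<theta>] \<gamma> ne] k'
      weyl_group_minus[OF weyl_group_inv[OF w], of \<theta>] by simp
  then show ?thesis by (metis edge_kind.exhaust)
qed

lemma highest_diamond_up:
  assumes \<theta>: "highest_root \<Phi> \<Delta> \<theta>" and z: "z \<in> WJ" "root_refl \<theta> \<circ> w = fl (root_refl \<theta> \<circ> w) \<circ> z"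
    and ne: "\<gamma> \<noteq> - inv w \<theta>" and k': "k' = k \<longleftrightarrow> coroot \<gamma> \<bullet> inv w \<theta> = 0"
  defines "y \<equiv> fl (w \<circ> root_refl \<gamma>)" and "y' \<equiv> fl (root_refl \<theta> \<circ> w \<circ> root_refl \<gamma>)"
  assumes b1: "E (Edge w (- inv w \<theta>) Quantum (fl (root_refl \<theta> \<circ> w)))"
    and b2: "E (Edge w \<gamma> k y)"
  shows "E (Edge (fl (root_refl \<theta> \<circ> w)) (z \<gamma>) k' y') \<and>
    E (Edge y (- inv y \<theta>) Quantum y') \<and>
    diamond \<Phi> \<Delta> J
      [Edge w (- inv w \<theta>) Quantum (fl (root_refl \<theta> \<circ> w)), Edge (fl (root_refl \<theta> \<circ> w)) (z \<gamma>) k' y']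
      [Edge w \<gamma> k y, Edge y (- inv y \<theta>) Quantum y']"
proof -
  note \<psi> = highest_root_affine_simple[OF \<theta>]
  have kind_\<psi>: "kind_of (- \<theta>) = Quantum"
    using highest_root_neg[OF \<theta>] by (simp add: kind_of_def neg_def split: if_splits)
  have w: "w \<in> W" and \<delta>: "- inv w \<theta> \<in> outer" and \<gamma>: "\<gamma> \<in> outer" and k: "k = kind_of (w \<gamma>)"
    using b1 b2 reps_W by (auto simp: edge_iff)
  have y: "y \<in> W"
    unfolding y_def by (rule reps_W[OF fl_reps[OF weyl_group_comp[OF w outer_refl[OF \<gamma>]]]])
  have inv_w: "inv w (- \<theta>) = - inv w \<theta>" by (rule weyl_group_minus[OF weyl_group_inv[OF w]])
  have inv_y: "inv y (- \<theta>) = - inv y \<theta>" by (rule weyl_group_minus[OF weyl_group_inv[OF y]])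
  have ne1: "\<gamma> \<noteq> inv w (- \<theta>)" "\<gamma> \<noteq> - inv w (- \<theta>)"
    unfolding inv_w using ne \<gamma> outer_not_minus[OF \<delta>] by auto
  have kind': "kind_of (root_refl \<theta> (w \<gamma>)) = k'"
    by (rule highest_root_kind[OF \<theta> w outer_root[OF \<gamma>] ne1 k'[unfolded k]])
  note diamond_up[OF \<psi> _ _ ne1(1), of z, unfolded root_refl_uminus_root kind' kind_\<psi> k[symmetric]
      y_def[symmetric] y'_def[symmetric] inv_w inv_y, OF z b1 b2]
  then show ?thesis by blast
qed

lemma highest_diamond_down:
  assumes \<theta>: "highest_root \<Phi> \<Delta> \<theta>" and z: "z \<in> WJ" "root_refl \<theta> \<circ> w = fl (root_refl \<theta> \<circ> w) \<circ> z"
    and ne: "\<gamma> \<noteq> - inv w \<theta>" and k': "k' = k \<longleftrightarrow> coroot \<gamma> \<bullet> inv w \<theta> = 0"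
  defines "y \<equiv> fl (w \<circ> root_refl \<gamma>)" and "y' \<equiv> fl (root_refl \<theta> \<circ> w \<circ> root_refl \<gamma>)"
  assumes z': "z' \<in> WJ" "root_refl \<theta> \<circ> y = y' \<circ> z'"
    and t1: "E (Edge w \<gamma> k y)" and t2: "E (Edge y' (z' (inv y \<theta>)) Quantum y)"
  shows "E (Edge (fl (root_refl \<theta> \<circ> w)) (z (inv w \<theta>)) Quantum w) \<and>
    E (Edge (fl (root_refl \<theta> \<circ> w)) (z \<gamma>) k' y') \<and>
    diamond \<Phi> \<Delta> J
      [Edge (fl (root_refl \<theta> \<circ> w)) (z (inv w \<theta>)) Quantum w, Edge w \<gamma> k y]
      [Edge (fl (root_refl \<theta> \<circ> w)) (z \<gamma>) k' y', Edge y' (z' (inv y \<theta>)) Quantum y]"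
proof -
  note \<psi> = highest_root_affine_simple[OF \<theta>]
  have kind_\<psi>: "kind_of (- \<theta>) = Quantum"
    using highest_root_neg[OF \<theta>] by (simp add: kind_of_def neg_def split: if_splits)
  have w: "w \<in> W" and \<gamma>: "\<gamma> \<in> outer" and k: "k = kind_of (w \<gamma>)"
    using t1 reps_W by (auto simp: edge_iff)
  have y: "y \<in> W"
    unfolding y_def by (rule reps_W[OF fl_reps[OF weyl_group_comp[OF w outer_refl[OF \<gamma>]]]])
  have inv_w: "inv w (- \<theta>) = - inv w \<theta>" by (rule weyl_group_minus[OF weyl_group_inv[OF w]])
  have inv_y: "inv y (- \<theta>) = - inv y \<theta>" by (rule weyl_group_minus[OF weyl_group_inv[OF y]])
  have ne1: "\<gamma> \<noteq> inv w (- \<theta>)" unfolding inv_w by (rule ne)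
  note down = diamond_down[OF \<psi> _ _ ne1, of z z', unfolded kind_\<psi> k[symmetric] y_def[symmetric]
      root_refl_uminus_root y'_def[symmetric] inv_w inv_y
      weyl_group_minus[OF z(1)] weyl_group_minus[OF z'(1)] minus_minus, OF z z' t1 t2]
  have ne2: "\<gamma> \<noteq> - inv w (- \<theta>)" unfolding inv_w minus_minus by (rule down(1))
  have kind': "kind_of (root_refl \<theta> (w \<gamma>)) = k'"
    by (rule highest_root_kind[OF \<theta> w outer_root[OF \<gamma>] ne1 ne2 k'[unfolded k]])
  show ?thesis using down(3-5) kind' by simp
qed

end

theorem lemma5p14:
  fixes \<Phi> \<Delta> J :: "'a::euclidean_space set"
    and \<theta> \<alpha> \<gamma> :: 'a
    and w z z' :: "'a \<Rightarrow> 'a"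
    and fl :: "('a \<Rightarrow> 'a) \<Rightarrow> ('a \<Rightarrow> 'a)"
    and E :: "'a edge \<Rightarrow> bool"
    and D :: "'a edge list \<Rightarrow> 'a edge list \<Rightarrow> bool"
  defines "fl \<equiv> min_rep \<Delta> J"
    and "E \<equiv> qb_edge \<Phi> \<Delta> J"
    and "D \<equiv> diamond \<Phi> \<Delta> J"
  assumes "irreducible_root_system \<Phi>"
    and "simple_roots \<Phi> \<Delta>"
    and "highest_root \<Phi> \<Delta> \<theta>"
    and "J \<subseteq> \<Delta>"
    and "\<alpha> \<in> \<Delta>"
    and "\<gamma> \<in> pos_roots \<Phi> \<Delta> - pos_roots_sub \<Phi> \<Delta> J"
    and "w \<in> min_reps \<Delta> J"
    and "z \<in> weyl_group J" and "root_refl \<theta> \<circ> w = fl (root_refl \<theta> \<circ> w) \<circ> z"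
    and "z' \<in> weyl_group J"
    and "root_refl \<theta> \<circ> fl (w \<circ> root_refl \<gamma>) = fl (root_refl \<theta> \<circ> w \<circ> root_refl \<gamma>) \<circ> z'"
  shows
   "(\<gamma> \<noteq> inv w \<alpha> \<longrightarrow>
    (let b1 = Edge w (inv w \<alpha>) Bruhat (root_refl \<alpha> \<circ> w);
         b2 = Edge w \<gamma> Bruhat (fl (w \<circ> root_refl \<gamma>));
         t1 = Edge (root_refl \<alpha> \<circ> w) \<gamma> Bruhat (root_refl \<alpha> \<circ> fl (w \<circ> root_refl \<gamma>));
         t2 = Edge (fl (w \<circ> root_refl \<gamma>)) (inv (fl (w \<circ> root_refl \<gamma>)) \<alpha>) Bruhat (root_refl \<alpha> \<circ> fl (w \<circ> root_refl \<gamma>))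
     in E b1 \<and> E b2 \<longrightarrow>
          root_refl \<alpha> \<circ> fl (w \<circ> root_refl \<gamma>) = root_refl \<alpha> \<circ> w \<circ> root_refl \<gamma> \<and>
          root_refl \<alpha> \<circ> w \<circ> root_refl \<gamma> = fl (root_refl \<alpha> \<circ> w \<circ> root_refl \<gamma>) \<and>
          E t1 \<and> E t2 \<and> D [b1, t1] [b2, t2]) \<and>
    (let b1 = Edge (root_refl \<alpha> \<circ> w) (- inv w \<alpha>) Bruhat w;
         b2 = Edge (root_refl \<alpha> \<circ> w) \<gamma> Bruhat (root_refl \<alpha> \<circ> fl (w \<circ> root_refl \<gamma>));
         t1 = Edge w \<gamma> Bruhat (fl (w \<circ> root_refl \<gamma>));
         t2 = Edge (root_refl \<alpha> \<circ> fl (w \<circ> root_refl \<gamma>)) (- inv (fl (w \<circ> root_refl \<gamma>)) \<alpha>) Bruhat (fl (w \<circ> root_refl \<gamma>))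
     in E t1 \<and> E t2 \<longrightarrow>
          root_refl \<alpha> \<circ> fl (w \<circ> root_refl \<gamma>) = root_refl \<alpha> \<circ> w \<circ> root_refl \<gamma> \<and>
          root_refl \<alpha> \<circ> w \<circ> root_refl \<gamma> = fl (root_refl \<alpha> \<circ> w \<circ> root_refl \<gamma>) \<and>
          E b1 \<and> E b2 \<and> D [b1, t1] [b2, t2])) \<and>
    (let b1 = Edge w (inv w \<alpha>) Bruhat (root_refl \<alpha> \<circ> w);
         b2 = Edge w \<gamma> Quantum (fl (w \<circ> root_refl \<gamma>));
         t1 = Edge (root_refl \<alpha> \<circ> w) \<gamma> Quantum (root_refl \<alpha> \<circ> fl (w \<circ> root_refl \<gamma>));
         t2 = Edge (fl (w \<circ> root_refl \<gamma>)) (inv (fl (w \<circ> root_refl \<gamma>)) \<alpha>) Bruhat (root_refl \<alpha> \<circ> fl (w \<circ> root_refl \<gamma>))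
     in E b1 \<and> E b2 \<longrightarrow>
          root_refl \<alpha> \<circ> fl (w \<circ> root_refl \<gamma>) = fl (root_refl \<alpha> \<circ> w \<circ> root_refl \<gamma>) \<and>
          E t1 \<and> E t2 \<and> D [b1, t1] [b2, t2]) \<and>
    (let b1 = Edge (root_refl \<alpha> \<circ> w) (- inv w \<alpha>) Bruhat w;
         b2 = Edge (root_refl \<alpha> \<circ> w) \<gamma> Quantum (root_refl \<alpha> \<circ> fl (w \<circ> root_refl \<gamma>));
         t1 = Edge w \<gamma> Quantum (fl (w \<circ> root_refl \<gamma>));
         t2 = Edge (root_refl \<alpha> \<circ> fl (w \<circ> root_refl \<gamma>)) (- inv (fl (w \<circ> root_refl \<gamma>)) \<alpha>) Bruhat (fl (w \<circ> root_refl \<gamma>))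
     in E t1 \<and> E t2 \<longrightarrow>
          root_refl \<alpha> \<circ> fl (w \<circ> root_refl \<gamma>) = fl (root_refl \<alpha> \<circ> w \<circ> root_refl \<gamma>) \<and>
          E b1 \<and> E b2 \<and> D [b1, t1] [b2, t2]) \<and>
    (coroot \<gamma> \<bullet> inv w \<theta> \<noteq> 0 \<longrightarrow>
    (let b1 = Edge w (- inv w \<theta>) Quantum (fl (root_refl \<theta> \<circ> w));
         b2 = Edge w \<gamma> Bruhat (fl (w \<circ> root_refl \<gamma>));
         t1 = Edge (fl (root_refl \<theta> \<circ> w)) (z \<gamma>) Quantum (fl (root_refl \<theta> \<circ> w \<circ> root_refl \<gamma>));
         t2 = Edge (fl (w \<circ> root_refl \<gamma>)) (- inv (fl (w \<circ> root_refl \<gamma>)) \<theta>) Quantum (fl (root_refl \<theta> \<circ> w \<circ> root_refl \<gamma>))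
     in E b1 \<and> E b2 \<longrightarrow>
          w \<circ> root_refl \<gamma> = fl (w \<circ> root_refl \<gamma>) \<and>
          E t1 \<and> E t2 \<and> D [b1, t1] [b2, t2]) \<and>
    (let b1 = Edge (fl (root_refl \<theta> \<circ> w)) (z (inv w \<theta>)) Quantum w;
         b2 = Edge (fl (root_refl \<theta> \<circ> w)) (z \<gamma>) Quantum (fl (root_refl \<theta> \<circ> w \<circ> root_refl \<gamma>));
         t1 = Edge w \<gamma> Bruhat (fl (w \<circ> root_refl \<gamma>));
         t2 = Edge (fl (root_refl \<theta> \<circ> w \<circ> root_refl \<gamma>)) (z' (inv (fl (w \<circ> root_refl \<gamma>)) \<theta>)) Quantum (fl (w \<circ> root_refl \<gamma>))
     in E t1 \<and> E t2 \<longrightarrow>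
          w \<circ> root_refl \<gamma> = fl (w \<circ> root_refl \<gamma>) \<and>
          E b1 \<and> E b2 \<and> D [b1, t1] [b2, t2])) \<and>
    (coroot \<gamma> \<bullet> inv w \<theta> = 0 \<longrightarrow>
    (let b1 = Edge w (- inv w \<theta>) Quantum (fl (root_refl \<theta> \<circ> w));
         b2 = Edge w \<gamma> Bruhat (fl (w \<circ> root_refl \<gamma>));
         t1 = Edge (fl (root_refl \<theta> \<circ> w)) (z \<gamma>) Bruhat (fl (root_refl \<theta> \<circ> w \<circ> root_refl \<gamma>));
         t2 = Edge (fl (w \<circ> root_refl \<gamma>)) (- inv (fl (w \<circ> root_refl \<gamma>)) \<theta>) Quantum (fl (root_refl \<theta> \<circ> w \<circ> root_refl \<gamma>))
     in E b1 \<and> E b2 \<longrightarrow>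
          w \<circ> root_refl \<gamma> = fl (w \<circ> root_refl \<gamma>) \<and>
          E t1 \<and> E t2 \<and> D [b1, t1] [b2, t2]) \<and>
    (let b1 = Edge (fl (root_refl \<theta> \<circ> w)) (z (inv w \<theta>)) Quantum w;
         b2 = Edge (fl (root_refl \<theta> \<circ> w)) (z \<gamma>) Bruhat (fl (root_refl \<theta> \<circ> w \<circ> root_refl \<gamma>));
         t1 = Edge w \<gamma> Bruhat (fl (w \<circ> root_refl \<gamma>));
         t2 = Edge (fl (root_refl \<theta> \<circ> w \<circ> root_refl \<gamma>)) (z' (inv (fl (w \<circ> root_refl \<gamma>)) \<theta>)) Quantum (fl (w \<circ> root_refl \<gamma>))
     in E t1 \<and> E t2 \<longrightarrow>
          w \<circ> root_refl \<gamma> = fl (w \<circ> root_refl \<gamma>) \<and>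
          E b1 \<and> E b2 \<and> D [b1, t1] [b2, t2])) \<and>
    (\<gamma> \<noteq> - inv w \<theta> \<and> coroot \<gamma> \<bullet> inv w \<theta> \<noteq> 0 \<longrightarrow>
    (let b1 = Edge w (- inv w \<theta>) Quantum (fl (root_refl \<theta> \<circ> w));
         b2 = Edge w \<gamma> Quantum (fl (w \<circ> root_refl \<gamma>));
         t1 = Edge (fl (root_refl \<theta> \<circ> w)) (z \<gamma>) Bruhat (fl (root_refl \<theta> \<circ> w \<circ> root_refl \<gamma>));
         t2 = Edge (fl (w \<circ> root_refl \<gamma>)) (- inv (fl (w \<circ> root_refl \<gamma>)) \<theta>) Quantum (fl (root_refl \<theta> \<circ> w \<circ> root_refl \<gamma>))
     in E b1 \<and> E b2 \<longrightarrow>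
          E t1 \<and> E t2 \<and> D [b1, t1] [b2, t2]) \<and>
    (let b1 = Edge (fl (root_refl \<theta> \<circ> w)) (z (inv w \<theta>)) Quantum w;
         b2 = Edge (fl (root_refl \<theta> \<circ> w)) (z \<gamma>) Bruhat (fl (root_refl \<theta> \<circ> w \<circ> root_refl \<gamma>));
         t1 = Edge w \<gamma> Quantum (fl (w \<circ> root_refl \<gamma>));
         t2 = Edge (fl (root_refl \<theta> \<circ> w \<circ> root_refl \<gamma>)) (z' (inv (fl (w \<circ> root_refl \<gamma>)) \<theta>)) Quantum (fl (w \<circ> root_refl \<gamma>))
     in E t1 \<and> E t2 \<longrightarrow>
          E b1 \<and> E b2 \<and> D [b1, t1] [b2, t2])) \<and>
    (\<gamma> \<noteq> - inv w \<theta> \<and> coroot \<gamma> \<bullet> inv w \<theta> = 0 \<longrightarrow>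
    (let b1 = Edge w (- inv w \<theta>) Quantum (fl (root_refl \<theta> \<circ> w));
         b2 = Edge w \<gamma> Quantum (fl (w \<circ> root_refl \<gamma>));
         t1 = Edge (fl (root_refl \<theta> \<circ> w)) (z \<gamma>) Quantum (fl (root_refl \<theta> \<circ> w \<circ> root_refl \<gamma>));
         t2 = Edge (fl (w \<circ> root_refl \<gamma>)) (- inv (fl (w \<circ> root_refl \<gamma>)) \<theta>) Quantum (fl (root_refl \<theta> \<circ> w \<circ> root_refl \<gamma>))
     in E b1 \<and> E b2 \<longrightarrow>
          E t1 \<and> E t2 \<and> D [b1, t1] [b2, t2]) \<and>
    (let b1 = Edge (fl (root_refl \<theta> \<circ> w)) (z (inv w \<theta>)) Quantum w;
         b2 = Edge (fl (root_refl \<theta> \<circ> w)) (z \<gamma>) Quantum (fl (root_refl \<theta> \<circ> w \<circ> root_refl \<gamma>));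
         t1 = Edge w \<gamma> Quantum (fl (w \<circ> root_refl \<gamma>));
         t2 = Edge (fl (root_refl \<theta> \<circ> w \<circ> root_refl \<gamma>)) (z' (inv (fl (w \<circ> root_refl \<gamma>)) \<theta>)) Quantum (fl (w \<circ> root_refl \<gamma>))
     in E t1 \<and> E t2 \<longrightarrow>
          E b1 \<and> E b2 \<and> D [b1, t1] [b2, t2]))"
proof -
  interpret P: parabolic_root_system \<Phi> \<Delta> J
    using \<open>irreducible_root_system \<Phi>\<close> \<open>simple_roots \<Phi> \<Delta>\<close> \<open>J \<subseteq> \<Delta>\<close>
    by unfold_locales (simp_all add: irreducible_root_system_def)
  note a = \<open>\<alpha> \<in> \<Delta>\<close> and \<theta> = \<open>highest_root \<Phi> \<Delta> \<theta>\<close>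
  have kind_\<alpha>: "P.kind_of \<alpha> = Bruhat"
    using P.simple_pos[OF a] by (simp add: P.kind_of_def)
  have kind_\<theta>: "P.kind_of (- \<theta>) = Quantum"
    using P.not_pos_minus[OF P.highest_root_pos[OF \<theta>]] by (simp add: P.kind_of_def)
  have w: "w \<in> P.W" using \<open>w \<in> min_reps \<Delta> J\<close> by (rule P.reps_W)
  have inv_w: "inv w (- \<theta>) = - inv w \<theta>" by (rule weyl_group_minus[OF weyl_group_inv[OF w]])
  note up = P.simple_diamond_up[OF a, folded fl_def E_def D_def]
    and down = P.simple_diamond_down[OF a, folded fl_def E_def D_def]
    and highest_up = P.highest_diamond_up[OF \<theta> \<open>z \<in> weyl_group J\<close>, folded fl_def E_def D_def,
      OF \<open>root_refl \<theta> \<circ> w = fl (root_refl \<theta> \<circ> w) \<circ> z\<close>]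
    and highest_down = P.highest_diamond_down[OF \<theta> \<open>z \<in> weyl_group J\<close> _ _ _ \<open>z' \<in> weyl_group J\<close>,
      folded fl_def E_def D_def, OF \<open>root_refl \<theta> \<circ> w = fl (root_refl \<theta> \<circ> w) \<circ> z\<close> _ _
      \<open>root_refl \<theta> \<circ> fl (w \<circ> root_refl \<gamma>) = fl (root_refl \<theta> \<circ> w \<circ> root_refl \<gamma>) \<circ> z'\<close>]
  note target = P.bruhat_target[folded E_def]
  have quantum_ne: "\<gamma> \<noteq> inv w \<alpha>" if "E (Edge w \<gamma> Quantum t)" for t
    by (rule P.label_neq_if_kind_neq[OF that[unfolded E_def]]) (simp add: kind_\<alpha>)
  have bruhat_ne: "\<gamma> \<noteq> - inv w \<theta>" if "E (Edge w \<gamma> Bruhat t)" for t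
    unfolding inv_w[symmetric]
    by (rule P.label_neq_if_kind_neq[OF that[unfolded E_def]]) (simp add: kind_\<theta>)
  have alpha_target: "root_refl \<alpha> \<circ> fl (w \<circ> root_refl \<gamma>) = root_refl \<alpha> \<circ> w \<circ> root_refl \<gamma>"
    if "E (Edge w \<gamma> Bruhat (fl (w \<circ> root_refl \<gamma>)))"
    using target[OF that] by (simp only: comp_assoc)
  then have alpha_minimal: "root_refl \<alpha> \<circ> w \<circ> root_refl \<gamma> = fl (root_refl \<alpha> \<circ> w \<circ> root_refl \<gamma>)"
    if "E (Edge w \<gamma> Bruhat (fl (w \<circ> root_refl \<gamma>)))"
      and "root_refl \<alpha> \<circ> fl (w \<circ> root_refl \<gamma>) = fl (root_refl \<alpha> \<circ> w \<circ> root_refl \<gamma>)"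
    using that by metis
  show ?thesis
    unfolding Let_def
  proof (intro conjI, goal_cases)
    case 1
    show ?case using up[of \<gamma> w Bruhat] down[of \<gamma> w Bruhat] alpha_target alpha_minimal by blast
  next
    case 2
    show ?case using up[of \<gamma> w Quantum] quantum_ne by blast
  next
    case 3
    show ?case using down[of \<gamma> w Quantum] quantum_ne by blast
  next
    case 4
    show ?case
    proof (rule impI, goal_cases)
      case 1
      then have kind: "Quantum = Bruhat \<longleftrightarrow> coroot \<gamma> \<bullet> inv w \<theta> = 0" by simp
      from 1 show ?case using highest_up[OF _ kind] highest_down[OF _ kind] bruhat_ne target[symmetric] by blast
    qed
  next
    case 5
    show ?case
    proof (rule impI, goal_cases)
      case 1
      then have kind: "Bruhat = Bruhat \<longleftrightarrow> coroot \<gamma> \<bullet> inv w \<theta> = 0" by simp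
      from 1 show ?case using highest_up[OF _ kind] highest_down[OF _ kind] bruhat_ne target[symmetric] by blast
    qed
  next
    case 6
    show ?case
    proof (rule impI, goal_cases)
      case 1
      then have kind: "Bruhat = Quantum \<longleftrightarrow> coroot \<gamma> \<bullet> inv w \<theta> = 0" by simp
      from 1 show ?case using highest_up[OF _ kind] highest_down[OF _ kind] by blast
    qed
  next
    case 7
    show ?case
    proof (rule impI, goal_cases)
      case 1
      then have kind: "Quantum = Quantum \<longleftrightarrow> coroot \<gamma> \<bullet> inv w \<theta> = 0" by simp
      from 1 show ?case using highest_up[OF _ kind] highest_down[OF _ kind] by blast
    qed
  qed
qed

end
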